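(* Let $0<r<1$ and let $\mathbb{A}=\{r<|z|<1\}$. For every invertible bounded Hilbert space operator $T$ such that $-T^{*2}T^2+(1+r^2)T^*T-r^2I\ge0$, the closed annulus $\mathbb{A}^{\mathrm{cl}}=\{r\le|z|\le1\}$ is a complete $\sqrt2$-spectral set for $T$.
   Context: For $K\ge1$ and an operator $T$ with spectrum contained in $\mathbb{A}^{\mathrm{cl}}$, the set $\mathbb{A}^{\mathrm{cl}}$ is completely $K$-spectral (a complete $K$-spectral set) for $T$ if $\|f(T)\|\le K\max_{z\in\mathbb{A}^{\mathrm{cl}}}\|f(z)\|$ for every $n\ge1$ and every rational $n\times n$ matrix-valued function $f$ with poles outside $\mathbb{A}^{\mathrm{cl}}$, where $\|f(z)\|$ is the operator norm of the matrix $f(z)$ and $f(T)$ acts on the direct sum of $n$ copies of the space. (Operators $T$ in the claim have spectrum contained in $\mathbb{A}^{\mathrm{cl}}$.) *)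

theory Defs
  imports "HOL-Analysis.Analysis" "HOL-Computational_Algebra.Polynomial_Factorial"
    "HOL-Computational_Algebra.Field_as_Ring"
begin

(* The inner product is linear in its first argument. *)

class complex_inner = real_normed_vector +
  fixes scaleC :: "complex \<Rightarrow> 'a \<Rightarrow> 'a" (infixr "*\<^sub>C" 75)
    and cinner :: "'a \<Rightarrow> 'a \<Rightarrow> complex"
  assumes scaleC_add_right: "a *\<^sub>C (x + y) = a *\<^sub>C x + a *\<^sub>C y"
    and scaleC_add_left: "(a + b) *\<^sub>C x = a *\<^sub>C x + b *\<^sub>C x"
    and scaleC_scaleC: "a *\<^sub>C b *\<^sub>C x = (a * b) *\<^sub>C x"
    and scaleC_of_real: "of_real t *\<^sub>C x = t *\<^sub>R x"
    and cinner_commute: "cinner x y = cnj (cinner y x)"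
    and cinner_add_left: "cinner (x + y) z = cinner x z + cinner y z"
    and cinner_scaleC_left: "cinner (a *\<^sub>C x) y = a * cinner x y"
    and cinner_norm: "cinner x x = of_real ((norm x)\<^sup>2)"

class chilbert_space = complex_inner + complete_space

instantiation complex :: chilbert_space
begin

definition scaleC_complex :: "complex \<Rightarrow> complex \<Rightarrow> complex"
  where "scaleC_complex a x = a * x"

definition cinner_complex :: "complex \<Rightarrow> complex \<Rightarrow> complex"
  where "cinner_complex x y = x * cnj y"

instance
proof
  fix x y z a b :: complex and t :: real
  show "a *\<^sub>C (x + y) = a *\<^sub>C x + a *\<^sub>C y" "(a + b) *\<^sub>C x = a *\<^sub>C x + b *\<^sub>C x"
    "a *\<^sub>C b *\<^sub>C x = (a * b) *\<^sub>C x"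
    by (simp_all add: scaleC_complex_def algebra_simps)
  show "of_real t *\<^sub>C x = t *\<^sub>R x"
    by (simp add: scaleC_complex_def scaleR_conv_of_real)
  show "cinner x y = cnj (cinner y x)"
    by (simp add: cinner_complex_def)
  show "cinner (x + y) z = cinner x z + cinner y z" "cinner (a *\<^sub>C x) y = a * cinner x y"
    by (simp_all add: cinner_complex_def scaleC_complex_def algebra_simps)
  show "cinner x x = of_real ((norm x)\<^sup>2)"
    unfolding cinner_complex_def by (rule complex_norm_square [symmetric])
qed

end

definition bounded_clinear :: "('a::complex_inner \<Rightarrow> 'b::complex_inner) \<Rightarrow> bool"
  where "bounded_clinear T \<longleftrightarrow> bounded_linear T \<and> (\<forall>a x. T (a *\<^sub>C x) = a *\<^sub>C T x)"

definition op_invertible :: "('a::chilbert_space \<Rightarrow> 'a) \<Rightarrow> bool"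
  where "op_invertible T \<longleftrightarrow>
    bounded_clinear T \<and> (\<exists>S. bounded_clinear S \<and> S \<circ> T = id \<and> T \<circ> S = id)"

definition op_spectrum :: "('a::chilbert_space \<Rightarrow> 'a) \<Rightarrow> complex set"
  where "op_spectrum T = {z. \<not> op_invertible (\<lambda>x. T x - z *\<^sub>C x)}"

(* For bounded T the adjoint exists by the Riesz representation theorem and is unique. *)

definition cadjoint :: "('a::chilbert_space \<Rightarrow> 'a) \<Rightarrow> 'a \<Rightarrow> 'a"
  where "cadjoint T = (THE S. \<forall>x y. cinner (T x) y = cinner x (S y))"

definition op_nonneg :: "('a::chilbert_space \<Rightarrow> 'a) \<Rightarrow> bool"
  where "op_nonneg A \<longleftrightarrow> (\<forall>x. cinner (A x) x \<in> \<real> \<and> 0 \<le> Re (cinner (A x) x))"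

(* Rational functions are elements of the fraction field of complex polynomials;
   quot_of_fract is the representation in lowest terms, so that the zeros of its
   second component are exactly the finite poles. *)

definition rat_poles :: "complex poly fract \<Rightarrow> complex set"
  where "rat_poles f = {z. poly (snd (quot_of_fract f)) z = 0}"

definition rat_eval :: "complex poly fract \<Rightarrow> complex \<Rightarrow> complex"
  where "rat_eval f z = poly (fst (quot_of_fract f)) z / poly (snd (quot_of_fract f)) z"

definition poly_op :: "complex poly \<Rightarrow> ('a::chilbert_space \<Rightarrow> 'a) \<Rightarrow> 'a \<Rightarrow> 'a"
  where "poly_op p T x = (\<Sum>k\<le>degree p. coeff p k *\<^sub>C (T ^^ k) x)"

(* Meaningful when no pole of f lies in the spectrum of T: the denominator then
   gives an invertible operator. *)

definition rat_op :: "complex poly fract \<Rightarrow> ('a::chilbert_space \<Rightarrow> 'a) \<Rightarrow> 'a \<Rightarrow> 'a"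
  where "rat_op f T = poly_op (fst (quot_of_fract f)) T \<circ> inv (poly_op (snd (quot_of_fract f)) T)"

(* Operator norm of the n x n block operator (A i j) on the l2-direct sum of n copies
   of the space.  Vectors are functions on nat of which only the values below n matter. *)

definition block_onorm :: "nat \<Rightarrow> (nat \<Rightarrow> nat \<Rightarrow> 'a::real_normed_vector \<Rightarrow> 'a) \<Rightarrow> real"
  where "block_onorm n A =
    (SUP x \<in> {x. L2_set (\<lambda>j. norm (x j)) {..<n} \<le> 1}.
       L2_set (\<lambda>i. norm (\<Sum>j<n. A i j (x j))) {..<n})"

(* A complex n x n matrix is a block operator on the direct sum of n copies of the
   complex line. *)

definition mat_onorm :: "nat \<Rightarrow> (nat \<Rightarrow> nat \<Rightarrow> complex) \<Rightarrow> real"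
  where "mat_onorm n M = block_onorm n (\<lambda>i j v. M i j * v)"

(* Intended for compact nonempty X, where the supremum over X is a maximum. *)

definition complete_spectral_set ::
    "real \<Rightarrow> complex set \<Rightarrow> ('a::chilbert_space \<Rightarrow> 'a) \<Rightarrow> bool"
  where "complete_spectral_set K X T \<longleftrightarrow>
    op_spectrum T \<subseteq> X \<and>
    (\<forall>n\<ge>1. \<forall>f :: nat \<Rightarrow> nat \<Rightarrow> complex poly fract.
      (\<forall>i<n. \<forall>j<n. rat_poles (f i j) \<inter> X = {}) \<longrightarrow>
      block_onorm n (\<lambda>i j. rat_op (f i j) T)
        \<le> K * (SUP z\<in>X. mat_onorm n (\<lambda>i j. rat_eval (f i j) z)))"

definition closed_annulus :: "real \<Rightarrow> complex set"
  where "closed_annulus r = {z. r \<le> cmod z \<and> cmod z \<le> 1}"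

end

theory Submission
  imports Defs "HOL-Computational_Algebra.Fundamental_Theorem_Algebra"
begin

text \<open>
  Write \<open>d(y) = (1 + r\<^sup>2)|T y|\<^sup>2 - r\<^sup>2|y|\<^sup>2 - |T T y|\<^sup>2\<close>; the hypothesis says that this quadratic form is
  nonnegative.  Along an orbit the numbers \<open>a m = |T\<^sup>m x|\<^sup>2\<close>, with \<open>m\<close> ranging over all integers, satisfy
  \<open>a (m+2) - (1 + r\<^sup>2) a (m+1) + r\<^sup>2 a m = - d(T\<^sup>m x) \<le> 0\<close>.  The characteristic roots are \<open>1\<close> and
  \<open>r\<^sup>2\<close>, so \<open>a\<close> is a nonnegative superharmonic sequence for a biased, hence transient, random walk.  The forms
  \<open>e(y) = |T y|\<^sup>2 - r\<^sup>2|y|\<^sup>2\<close> and \<open>c(y) = |y|\<^sup>2 - |T y|\<^sup>2\<close> are therefore nonnegative too (otherwise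
  \<open>a\<close> would become negative at one end of the orbit).  Thus \<open>r|y| \<le> |T y| \<le> |y|\<close>, which already
  puts the spectrum of the invertible operator \<open>T\<close> into the annulus, and the Riesz decomposition of \<open>a\<close> at \<open>m = 0\<close> reads
  \<open>(1 - r\<^sup>2)|x|\<^sup>2 = (\<Sum>m. w m * d(T\<^sup>m x)) + E(x) + G(x)\<close>.  Here the Green function is, up to a
  factor, \<open>w m = min 1 (r powi (-2(m+1)))\<close>, and the boundary terms \<open>E(x) = lim e(T\<^sup>N x)\<close> and
  \<open>G(x) = lim r\<^sup>2\<^sup>N c(S\<^sup>N x)\<close>, where \<open>S\<close> is the inverse of \<open>T\<close>, satisfy \<open>E(T x) = E(x)\<close> and
  \<open>G(T x) = r\<^sup>2 G(x)\<close> (\<open>energy_identity\<close> is the version with finite \<open>N\<close>).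

  Now let \<open>f\<close> be a matrix of Laurent polynomials with \<open>|f| \<le> M\<close> on both boundary circles.  On the
  orbit \<open>m \<mapsto> T\<^sup>m x\<close> the operator \<open>f(T)\<close> is a convolution.  By Parseval's identity a convolution is
  bounded by \<open>M\<close> for the constant weight, where the shift is unitary, if \<open>|f| \<le> M\<close> on the unit
  circle, and for the weight \<open>r powi (-2m)\<close>, where the shift is \<open>r\<close> times a unitary, if \<open>|f| \<le> M\<close> on
  the circle of radius \<open>r\<close> (\<open>convolution_bound\<close>, \<open>weighted_convolution_bound\<close>); matrix
  coefficients are handled by orthogonalising with respect to the form
  (\<open>matrix_amplification\<close>).  With the second weight multiplied by \<open>r powi (-2)\<close>, the minimum of the
  two is \<open>w\<close>; it agrees with the first one for \<open>m \<ge> 0\<close> and with the second one for \<open>m < 0\<close>.  Splitting the orbit at \<open>0\<close> into \<open>p + q\<close>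
  gives \<open>|f(p + q)|\<^sup>2 \<le> 2|f p|\<^sup>2 + 2|f q|\<^sup>2 \<le> 2 M\<^sup>2 |p + q|\<^sup>2\<close> in the weight \<open>w\<close>.  This is where
  the constant \<open>sqrt 2\<close> comes from (\<open>interior_energy_bound\<close>).  On the boundary terms \<open>f(T)\<close> is
  even bounded by \<open>M\<close>, by averaging over long stretches of the orbit (\<open>cesaro_comparison\<close>).  Adding up
  gives \<open>laurent_estimate\<close>.

  Rational functions without poles in the annulus are limits of Laurent polynomials, uniformly on the
  annulus and, at \<open>T\<close>, in the operator norm: the pairs \<open>(g, G)\<close> of limits form an algebra which
  contains the resolvents by the Neumann series, hence the inverses of all admissible denominators
  (\<open>approximable_rational\<close>).
\<close>

section \<open>Scalar multiplication and bounded complex-linear maps\<close>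

subclass (in chilbert_space) banach ..

lemma scaleC_zero_left [simp]: "0 *\<^sub>C x = (0::'a::complex_inner)"
  using scaleC_of_real [of 0 x] by simp

lemma scaleC_zero_right [simp]: "a *\<^sub>C 0 = (0::'a::complex_inner)"
  using scaleC_add_right [of a 0 "0::'a"] by simp

lemma scaleC_one [simp]: "1 *\<^sub>C x = (x::'a::complex_inner)"
  using scaleC_of_real [of 1 x] by simp

lemma scaleC_minus_left: "(- a) *\<^sub>C x = - (a *\<^sub>C (x::'a::complex_inner))"
  using scaleC_add_left [of a "- a" x] by (simp add: add_eq_0_iff)

lemma scaleC_minus_right: "a *\<^sub>C (- x) = - (a *\<^sub>C (x::'a::complex_inner))"
  using scaleC_add_right [of a x "- x"] by (simp add: add_eq_0_iff)

lemma scaleC_diff_right: "a *\<^sub>C (x - y) = a *\<^sub>C x - a *\<^sub>C (y::'a::complex_inner)"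
  using scaleC_add_right [of a x "- y"] by (simp add: scaleC_minus_right)

lemma scaleC_sum_right: "a *\<^sub>C (\<Sum>i\<in>A. f i) = (\<Sum>i\<in>A. a *\<^sub>C (f i :: 'a::complex_inner))"
  by (induction A rule: infinite_finite_induct) (simp_all add: scaleC_add_right)

lemma scaleC_sum_left: "(\<Sum>i\<in>A. c i) *\<^sub>C (x :: 'a::complex_inner) = (\<Sum>i\<in>A. c i *\<^sub>C x)"
  by (induction A rule: infinite_finite_induct) (simp_all add: scaleC_add_left)


lemma bounded_clinearD:
  assumes "bounded_clinear T"
  shows "bounded_linear T" "T (x + y) = T x + T y" "T (x - y) = T x - T y" "T 0 = 0"
    "T (- x) = - T x" "T (a *\<^sub>C x) = a *\<^sub>C T x" "T (sum f A) = (\<Sum>i\<in>A. T (f i))"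
proof -
  show lin: "bounded_linear T" and "T (a *\<^sub>C x) = a *\<^sub>C T x"
    using assms by (auto simp: bounded_clinear_def)
  interpret bounded_linear T by (rule lin)
  show "T (x + y) = T x + T y" "T (x - y) = T x - T y" "T 0 = 0" "T (- x) = - T x"
    "T (sum f A) = (\<Sum>i\<in>A. T (f i))"
    by (simp_all add: add diff zero neg sum)
qed

lemma bounded_clinear_id [simp]: "bounded_clinear (\<lambda>x. x)"
  by (simp add: bounded_clinear_def bounded_linear_ident)

lemma bounded_clinear_zero [simp]: "bounded_clinear (\<lambda>x. 0)"
  by (simp add: bounded_clinear_def bounded_linear_zero)

lemma bounded_clinear_compose:
  assumes "bounded_clinear f" "bounded_clinear g"
  shows "bounded_clinear (\<lambda>x. f (g x))"
  using assms by (auto simp: bounded_clinear_def intro: bounded_linear_compose)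

lemma bounded_clinear_add:
  assumes "bounded_clinear f" "bounded_clinear g"
  shows "bounded_clinear (\<lambda>x. f x + g x)"
  using assms by (auto simp: bounded_clinear_def scaleC_add_right intro: bounded_linear_add)

lemma norm_scaleC: "norm (a *\<^sub>C (x::'a::complex_inner)) = cmod a * norm x"
proof -
  have "of_real ((norm (a *\<^sub>C x))\<^sup>2) = cinner (a *\<^sub>C x) (a *\<^sub>C x)"
    by (simp add: cinner_norm)
  also have "\<dots> = a * cnj (cinner (a *\<^sub>C x) x)"
    by (simp only: cinner_scaleC_left cinner_commute [of x "a *\<^sub>C x"])
  also have "\<dots> = (a * cnj a) * of_real ((norm x)\<^sup>2)"
    by (simp add: cinner_scaleC_left cinner_norm)
  also have "\<dots> = of_real ((cmod a * norm x)\<^sup>2)"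
    by (simp only: complex_norm_square [symmetric] power_mult_distrib of_real_mult)
  finally have "(norm (a *\<^sub>C x))\<^sup>2 = (cmod a * norm x)\<^sup>2" by (simp only: of_real_eq_iff)
  then show ?thesis by (simp add: power2_eq_iff_nonneg)
qed

lemma bounded_clinear_scaleC [simp]: "bounded_clinear (\<lambda>x. a *\<^sub>C x)"
proof -
  have "bounded_linear (\<lambda>x::'a. a *\<^sub>C x)"
  proof (rule bounded_linear_intro [where K = "cmod a"])
    fix t :: real and x :: 'a
    show "a *\<^sub>C (t *\<^sub>R x) = t *\<^sub>R (a *\<^sub>C x)"
      by (simp add: scaleC_of_real [symmetric] scaleC_scaleC mult.commute)
  qed (auto simp: scaleC_add_right norm_scaleC mult.commute)
  then show ?thesis by (simp add: bounded_clinear_def scaleC_scaleC mult.commute)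
qed

lemma bounded_clinear_sum:
  assumes "\<And>i. i \<in> A \<Longrightarrow> bounded_clinear (f i)"
  shows "bounded_clinear (\<lambda>x. \<Sum>i\<in>A. f i x)"
  using assms by (induction A rule: infinite_finite_induct) (auto intro: bounded_clinear_add)

lemma bounded_clinear_funpow:
  fixes f :: "'a::complex_inner \<Rightarrow> 'a"
  assumes "bounded_clinear f" shows "bounded_clinear (f ^^ n)"
proof (induction n)
  case 0
  then show ?case by (simp add: id_def)
next
  case (Suc n)
  then show ?case using bounded_clinear_compose [OF assms] by (simp add: o_def)
qed


section \<open>Positive semidefinite sesquilinear forms\<close>

locale psd_form =
  fixes B :: "'a::complex_inner \<Rightarrow> 'a \<Rightarrow> complex"
  assumes add_left: "B (x + y) z = B x z + B y z"
    and scale_left: "B (a *\<^sub>C x) y = a * B x y"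
    and hermitian: "B x y = cnj (B y x)"
    and nonneg: "0 \<le> Re (B x x)"
begin

definition Q :: "'a \<Rightarrow> real" where "Q x = Re (B x x)"

lemma Q_nonneg [simp]: "0 \<le> Q x"
  by (simp add: Q_def nonneg)

lemma B_self: "B x x = of_real (Q x)"
proof -
  have "Im (B x x) = Im (cnj (B x x))" by (rule arg_cong [OF hermitian])
  then show ?thesis by (simp add: complex_eq_iff Q_def)
qed

lemma add_right: "B x (y + z) = B x y + B x z"
proof -
  have "B x (y + z) = cnj (B (y + z) x)" by (rule hermitian)
  also have "\<dots> = cnj (B y x) + cnj (B z x)" by (simp add: add_left)
  finally show ?thesis by (simp only: hermitian [symmetric])
qed

lemma scale_right: "B x (a *\<^sub>C y) = cnj a * B x y"
proof -
  have "B x (a *\<^sub>C y) = cnj (B (a *\<^sub>C y) x)" by (rule hermitian)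
  also have "\<dots> = cnj a * cnj (B y x)" by (simp add: scale_left)
  finally show ?thesis by (simp only: hermitian [symmetric])
qed

lemma zero_left [simp]: "B 0 y = 0"
  using scale_left [of 0 0 y] by simp

lemma zero_right [simp]: "B y 0 = 0"
  using scale_right [of y 0 0] by simp

lemma Q_zero [simp]: "Q 0 = 0"
  by (simp add: Q_def)

lemma sum_left: "B (\<Sum>i\<in>A. f i) y = (\<Sum>i\<in>A. B (f i) y)"
  by (induction A rule: infinite_finite_induct) (simp_all add: add_left)

lemma sum_right: "B y (\<Sum>i\<in>A. f i) = (\<Sum>i\<in>A. B y (f i))"
  by (induction A rule: infinite_finite_induct) (simp_all add: add_right)

lemma minus_left: "B (- x) y = - B x y"
  using scale_left [of "- 1" x y] by (simp add: scaleC_minus_left)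

lemma diff_left: "B (x - y) z = B x z - B y z"
  using add_left [of x "- y" z] by (simp add: minus_left)

lemma Q_scale: "Q (a *\<^sub>C x) = (cmod a)\<^sup>2 * Q x"
proof -
  have "B (a *\<^sub>C x) (a *\<^sub>C x) = (a * cnj a) * B x x"
    by (simp add: scale_left scale_right)
  also have "\<dots> = of_real ((cmod a)\<^sup>2 * Q x)"
    by (simp only: complex_norm_square [symmetric] B_self of_real_mult)
  finally show ?thesis
    by (simp only: B_self of_real_eq_iff)
qed

lemma Q_add: "Q (x + y) = Q x + Q y + 2 * Re (B x y)"
proof -
  have "Re (B y x) = Re (cnj (B x y))" by (rule arg_cong [OF hermitian])
  then show ?thesis by (simp add: Q_def add_left add_right)
qed

lemma Q_add_le: "Q (x + y) \<le> 2 * Q x + 2 * Q y"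
proof -
  have "0 \<le> Q (x + (- 1) *\<^sub>C y)" by simp
  also have "\<dots> = Q x + Q y - 2 * Re (B x y)"
    by (simp add: Q_add Q_scale scale_right)
  finally show ?thesis by (simp add: Q_add)
qed

text \<open>
  A semidefinite form may have null vectors, but they are orthogonal to everything. This is what keeps
  the Gram-Schmidt process below running without a normalisation.
\<close>

lemma null_vector:
  assumes "Q w = 0" shows "B u w = 0"
proof (rule ccontr)
  assume ne: "B u w \<noteq> 0"
  define b where "b = (cmod (B u w))\<^sup>2"
  have b: "b > 0" using ne by (simp add: b_def)
  have "0 \<le> Q u - 2 * t * b" for t :: real
  proof -
    have "0 \<le> Q (u + (- of_real t * B u w) *\<^sub>C w)" by simp
    also have "\<dots> = Q u - 2 * t * Re (cnj (B u w) * B u w)"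
      by (simp only: Q_add) (simp add: Q_scale assms scale_right algebra_simps)
    also have "cnj (B u w) * B u w = of_real b"
      by (simp add: b_def complex_norm_square mult.commute del: of_real_power)
    finally show ?thesis by simp
  qed
  from this [of "(Q u + 1) / (2 * b)"] b show False by simp
qed

text \<open>
  Gram-Schmidt without normalisation: the family may contain null vectors, which
  makes the expansion of the given vectors exact for a semidefinite form as well.
\<close>

lemma orthogonal_family:
  fixes u :: "nat \<Rightarrow> 'a"
  shows "\<exists>w c. (\<forall>l<n. \<forall>l'<n. l \<noteq> l' \<longrightarrow> B (w l) (w l') = 0) \<and>
    (\<forall>j<n. u j = (\<Sum>l<n. c j l *\<^sub>C w l))"
proof (induction n)
  case 0
  show ?case by simp
next
  case (Suc n)
  then obtain w c where
    orth: "\<And>l l'. \<lbrakk>l < n; l' < n; l \<noteq> l'\<rbrakk> \<Longrightarrow> B (w l) (w l') = 0" and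
    expand: "\<And>j. j < n \<Longrightarrow> u j = (\<Sum>l<n. c j l *\<^sub>C w l)"
    by blast
  define b where "b l = B (u n) (w l) / B (w l) (w l)" for l
  define v where "v = u n - (\<Sum>l<n. b l *\<^sub>C w l)"
  have v0: "B v (w l) = 0" if l: "l < n" for l
  proof -
    have "B (\<Sum>k<n. b k *\<^sub>C w k) (w l) = (\<Sum>k<n. if k = l then b l * B (w l) (w l) else 0)"
      unfolding sum_left by (rule sum.cong) (use l orth in \<open>auto simp: scale_left\<close>)
    also have "\<dots> = b l * B (w l) (w l)" using l by simp
    also have "\<dots> = B (u n) (w l)"
      \<comment> \<open>if the denominator of \<open>b l\<close> vanishes, so does the numerator\<close>
      using null_vector [of "w l" "u n"] by (auto simp: b_def B_self)
    finally show ?thesis by (simp add: v_def diff_left)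
  qed
  have v0': "B (w l) v = 0" if "l < n" for l
    using v0 [OF that] hermitian [of "w l" v] by simp
  define w' where "w' = w(n := v)"
  define c' where "c' j l = (if j < n then if l < n then c j l else 0
    else if l < n then b l else 1)" for j l
  have "\<forall>l<Suc n. \<forall>l'<Suc n. l \<noteq> l' \<longrightarrow> B (w' l) (w' l') = 0"
    using orth v0 v0' by (auto simp: w'_def less_Suc_eq)
  moreover have "\<forall>j<Suc n. u j = (\<Sum>l<Suc n. c' j l *\<^sub>C w' l)"
    using expand by (auto simp: less_Suc_eq c'_def w'_def v_def)
  ultimately show ?case by blast
qed

lemma Q_orthogonal_sum:
  fixes n :: nat
  assumes "\<And>l l'. \<lbrakk>l < n; l' < n; l \<noteq> l'\<rbrakk> \<Longrightarrow> B (w l) (w l') = 0"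
  shows "Q (\<Sum>l<n. a l *\<^sub>C w l) = (\<Sum>l<n. (cmod (a l))\<^sup>2 * Q (w l))"
proof -
  have "B (\<Sum>l<n. a l *\<^sub>C w l) (\<Sum>l<n. a l *\<^sub>C w l) =
      (\<Sum>l<n. \<Sum>k<n. if k = l then a l * cnj (a l) * B (w l) (w l) else 0)"
    unfolding sum_left sum_right
    by (intro sum.cong refl) (use assms in \<open>auto simp: scale_left scale_right\<close>)
  also have "\<dots> = (\<Sum>l<n. of_real ((cmod (a l))\<^sup>2 * Q (w l)))"
  proof (rule sum.cong [OF refl])
    fix l assume "l \<in> {..<n}"
    then have "(\<Sum>k<n. if k = l then a l * cnj (a l) * B (w l) (w l) else 0) =
        a l * cnj (a l) * B (w l) (w l)" by simp
    then show "(\<Sum>k<n. if k = l then a l * cnj (a l) * B (w l) (w l) else 0) =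
        of_real ((cmod (a l))\<^sup>2 * Q (w l))"
      by (simp only: complex_norm_square [symmetric] B_self of_real_mult)
  qed
  finally show ?thesis by (simp add: Q_def)
qed

text \<open>
  A scalar matrix keeps its norm when it acts on vectors from a semi-inner product space: in an orthogonal
  family the form becomes a weighted sum of absolute squares, and the matrix acts on each coordinate column separately.
\<close>

lemma matrix_amplification:
  fixes F :: "nat \<Rightarrow> nat \<Rightarrow> complex" and u :: "nat \<Rightarrow> 'a"
  assumes F: "\<And>v. (\<Sum>i<n. (cmod (\<Sum>j<n. F i j * v j))\<^sup>2) \<le> M * (\<Sum>j<n. (cmod (v j))\<^sup>2)"
  shows "(\<Sum>i<n. Q (\<Sum>j<n. F i j *\<^sub>C u j)) \<le> M * (\<Sum>j<n. Q (u j))"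
proof -
  obtain w c where
    orth: "\<And>l l'. \<lbrakk>l < n; l' < n; l \<noteq> l'\<rbrakk> \<Longrightarrow> B (w l) (w l') = 0" and
    expand: "\<And>j. j < n \<Longrightarrow> u j = (\<Sum>l<n. c j l *\<^sub>C w l)"
    using orthogonal_family [of n u] by blast
  have Fu: "(\<Sum>j<n. F i j *\<^sub>C u j) = (\<Sum>l<n. (\<Sum>j<n. F i j * c j l) *\<^sub>C w l)" for i
  proof -
    have "(\<Sum>j<n. F i j *\<^sub>C u j) = (\<Sum>j<n. \<Sum>l<n. (F i j * c j l) *\<^sub>C w l)"
      by (rule sum.cong) (auto simp: expand scaleC_sum_right scaleC_scaleC)
    also have "\<dots> = (\<Sum>l<n. \<Sum>j<n. (F i j * c j l) *\<^sub>C w l)" by (rule sum.swap)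
    finally show ?thesis by (simp add: scaleC_sum_left)
  qed
  have "(\<Sum>i<n. Q (\<Sum>j<n. F i j *\<^sub>C u j)) =
      (\<Sum>i<n. \<Sum>l<n. (cmod (\<Sum>j<n. F i j * c j l))\<^sup>2 * Q (w l))"
    unfolding Fu by (simp add: Q_orthogonal_sum [OF orth])
  also have "\<dots> = (\<Sum>l<n. \<Sum>i<n. (cmod (\<Sum>j<n. F i j * c j l))\<^sup>2 * Q (w l))"
    by (rule sum.swap)
  also have "\<dots> = (\<Sum>l<n. (\<Sum>i<n. (cmod (\<Sum>j<n. F i j * c j l))\<^sup>2) * Q (w l))"
    by (simp add: sum_distrib_right)
  also have "\<dots> \<le> (\<Sum>l<n. (M * (\<Sum>j<n. (cmod (c j l))\<^sup>2)) * Q (w l))"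
    by (intro sum_mono mult_right_mono F) simp
  also have "\<dots> = M * (\<Sum>l<n. \<Sum>j<n. (cmod (c j l))\<^sup>2 * Q (w l))"
    by (simp add: sum_distrib_left sum_distrib_right mult.assoc)
  also have "(\<Sum>l<n. \<Sum>j<n. (cmod (c j l))\<^sup>2 * Q (w l)) = (\<Sum>j<n. Q (u j))"
    by (subst sum.swap) (simp add: expand Q_orthogonal_sum [OF orth])
  finally show ?thesis .
qed

text \<open>
  Parseval's identity for the discrete Fourier transform. The order \<open>L\<close> exceeds the diameter of the
  support \<open>A\<close>, so that no two indices of \<open>A\<close> are congruent modulo \<open>L\<close>; finite sums over roots of unity
  then do the work of integrals over the circle.
\<close>

lemma parseval:
  fixes s :: "int \<Rightarrow> 'a" and L :: nat
  assumes fin: "finite A" and L: "\<And>m m'. \<lbrakk>m \<in> A; m' \<in> A\<rbrakk> \<Longrightarrow> \<bar>m - m'\<bar> < int L"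
    and Lpos: "L > 0"
  shows "(\<Sum>l<L. Q (\<Sum>m\<in>A. (cis (2 * pi * real l / real L) powi (- m)) *\<^sub>C s m)) =
    real L * (\<Sum>m\<in>A. Q (s m))"
proof -
  define z where "z l = cis (2 * pi * real l / real L)" for l
  have roots: "(\<Sum>l<L. z l powi (- m) * cnj (z l powi (- m'))) = (if m' = m then of_nat L else 0)"
    if mm: "m \<in> A" "m' \<in> A" for m m'
  proof -
    define w where "w = cis (2 * pi * of_int (m' - m) / real L)"
    have "z l powi (- m) * cnj (z l powi (- m')) = w ^ l" for l
    proof -
      have "z l powi (- m) * cnj (z l powi (- m')) = z l powi (m' - m)"
        by (simp add: z_def cis_power_int cis_cnj cis_mult algebra_simps diff_divide_distrib)
      also have "\<dots> = w ^ l"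
        unfolding z_def w_def cis_power_int Complex.DeMoivre
        by (rule arg_cong [where f = cis]) (simp add: algebra_simps)
      finally show ?thesis .
    qed
    then have eq: "(\<Sum>l<L. z l powi (- m) * cnj (z l powi (- m'))) = (\<Sum>l<L. w ^ l)" by simp
    show ?thesis
    proof (cases "m' = m")
      case True
      then show ?thesis unfolding eq by (simp add: w_def)
    next
      case False
      have "w ^ L = 1"
        using Lpos by (simp add: w_def Complex.DeMoivre)
      moreover have "w \<noteq> 1"
      proof
        assume "w = 1"
        then have "cos (2 * pi * of_int (m' - m) / real L) = 1"
          by (simp add: w_def complex_eq_iff)
        then obtain k :: int where "2 * pi * of_int (m' - m) / real L = of_int k * 2 * pi"
          using cos_one_2pi_int by blast
        then have "2 * pi * of_int (m' - m) = 2 * pi * (real_of_int k * real L)"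
          using Lpos by (simp add: field_simps)
        then have "of_int (m' - m) = real_of_int k * real L"
          by (simp only: mult_cancel_left) simp
        then have k: "m' - m = k * int L"
          by (metis of_int_eq_iff of_int_mult of_int_of_nat_eq)
        then have "k \<noteq> 0" using False by auto
        then have "1 * int L \<le> \<bar>k\<bar> * int L" by (intro mult_right_mono) auto
        then have "int L \<le> \<bar>k * int L\<bar>" by (simp add: abs_mult)
        with k L [OF mm] show False by (simp add: abs_minus_commute)
      qed
      ultimately show ?thesis unfolding eq using False by (simp add: geometric_sum)
    qed
  qed
  have "(\<Sum>l<L. B (\<Sum>m\<in>A. (z l powi (- m)) *\<^sub>C s m) (\<Sum>m\<in>A. (z l powi (- m)) *\<^sub>C s m)) =
     (\<Sum>l<L. \<Sum>m\<in>A. \<Sum>m'\<in>A. z l powi (- m) * cnj (z l powi (- m')) * B (s m) (s m'))"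
    unfolding sum_left unfolding sum_right
    by (intro sum.cong refl) (simp add: scale_left scale_right)
  also have "\<dots> = (\<Sum>m\<in>A. \<Sum>m'\<in>A. \<Sum>l<L. z l powi (- m) * cnj (z l powi (- m')) * B (s m) (s m'))"
    by (subst sum.swap) (rule sum.cong [OF refl], rule sum.swap)
  also have "\<dots> = (\<Sum>m\<in>A. \<Sum>m'\<in>A. if m' = m then of_nat L * B (s m) (s m) else 0)"
    unfolding sum_distrib_right [symmetric]
    by (intro sum.cong refl) (subst roots, auto)
  also have "\<dots> = (\<Sum>m\<in>A. of_nat L * of_real (Q (s m)))"
    using fin by (simp add: B_self)
  finally have "Re (\<Sum>l<L. B (\<Sum>m\<in>A. (z l powi (- m)) *\<^sub>C s m) (\<Sum>m\<in>A. (z l powi (- m)) *\<^sub>C s m)) =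
     real L * (\<Sum>m\<in>A. Q (s m))" by (simp add: sum_distrib_left)
  then show ?thesis by (simp add: Q_def z_def)
qed

end

section \<open>Convolutions on sequences over the integers\<close>

lemma sum_int_translate:
  fixes g :: "int \<Rightarrow> 'b::comm_monoid_add"
  assumes "finite A'" and "(\<lambda>m. m - c) ` A \<subseteq> A'" and "\<And>m. m \<notin> A \<Longrightarrow> g m = 0"
  shows "(\<Sum>m\<in>A'. g (m + c)) = (\<Sum>m\<in>A. g m)"
proof -
  have "(\<Sum>m\<in>A. g m) = (\<Sum>m\<in>(\<lambda>m. m - c) ` A. g (m + c))"
    by (subst sum.reindex) (auto simp: inj_on_def)
  also have "\<dots> = (\<Sum>m\<in>A'. g (m + c))"
  proof (rule sum.mono_neutral_left)
    show "\<forall>m\<in>A' - (\<lambda>m. m - c) ` A. g (m + c) = 0"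
    proof
      fix m assume "m \<in> A' - (\<lambda>m. m - c) ` A"
      then have "m + c \<notin> A" by force
      then show "g (m + c) = 0" by (rule assms(3))
    qed
  qed (use assms in auto)
  finally show ?thesis by simp
qed

context psd_form
begin

text \<open>
  The convolution with coefficients \<open>F i j k\<close> and exponents \<open>e k\<close> becomes, after a Fourier transform, the
  pointwise multiplication by its symbol, so its norm is at most that of the symbol on the unit circle.
  The window \<open>C\<close> serves to evaluate the output only where the truncated input agrees with an orbit.
\<close>

lemma convolution_bound:
  fixes F :: "nat \<Rightarrow> nat \<Rightarrow> nat \<Rightarrow> complex" and e :: "nat \<Rightarrow> int" and s :: "int \<Rightarrow> nat \<Rightarrow> 'a"
  assumes F: "\<And>z v. cmod z = 1 \<Longrightarrow>
      (\<Sum>i<n. (cmod (\<Sum>j<n. (\<Sum>k\<le>d. F i j k * z powi e k) * v j))\<^sup>2)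
        \<le> M * (\<Sum>j<n. (cmod (v j))\<^sup>2)"
    and A: "finite A" "\<And>m j. m \<notin> A \<Longrightarrow> s m j = 0" and C: "finite C"
  shows "(\<Sum>m\<in>C. \<Sum>i<n. Q (\<Sum>j<n. \<Sum>k\<le>d. F i j k *\<^sub>C s (m + e k) j))
    \<le> M * (\<Sum>m\<in>A. \<Sum>j<n. Q (s m j))"
proof -
  define t where "t m i = (\<Sum>j<n. \<Sum>k\<le>d. F i j k *\<^sub>C s (m + e k) j)" for m i
  \<comment> \<open>\<open>A'\<close> supports both the input and the output of the convolution\<close>
  define A' where "A' = A \<union> C \<union> (\<Union>k\<le>d. (\<lambda>m. m - e k) ` A)"
  have A': "finite A'" "A \<subseteq> A'" "C \<subseteq> A'" "\<And>k. k \<le> d \<Longrightarrow> (\<lambda>m. m - e k) ` A \<subseteq> A'"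
    using A C by (auto simp: A'_def)
  define L where "L = Suc (nat (Max ((\<lambda>(m, m'). \<bar>m - m'\<bar>) ` (A' \<times> A'))))"
  have L: "\<bar>m - m'\<bar> < int L" if "m \<in> A'" "m' \<in> A'" for m m'
  proof -
    have "\<bar>m - m'\<bar> \<le> Max ((\<lambda>(m, m'). \<bar>m - m'\<bar>) ` (A' \<times> A'))"
      by (rule Max_ge) (use that A'(1) in auto)
    then show ?thesis unfolding L_def by linarith
  qed
  have Lpos: "L > 0" by (simp add: L_def)
  define z where "z l = cis (2 * pi * real l / real L)" for l
  define sh where "sh l j = (\<Sum>m\<in>A'. (z l powi (- m)) *\<^sub>C s m j)" for l j
  define th where "th l i = (\<Sum>m\<in>A'. (z l powi (- m)) *\<^sub>C t m i)" for l i
  have symbol: "th l i = (\<Sum>j<n. (\<Sum>k\<le>d. F i j k * z l powi e k) *\<^sub>C sh l j)" for l i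
  proof -
    have z0: "z l \<noteq> 0" by (simp add: z_def)
    have shift: "(\<Sum>m\<in>A'. (z l powi (- m)) *\<^sub>C s (m + e k) j) = (z l powi e k) *\<^sub>C sh l j"
      if "k \<le> d" for k j
    proof -
      have "(\<Sum>m\<in>A'. (z l powi (- m)) *\<^sub>C s (m + e k) j) =
          (\<Sum>m\<in>A'. (z l powi (e k - (m + e k))) *\<^sub>C s (m + e k) j)" by simp
      also have "\<dots> = (\<Sum>m\<in>A. (z l powi (e k - m)) *\<^sub>C s m j)"
        by (rule sum_int_translate [where g = "\<lambda>m. (z l powi (e k - m)) *\<^sub>C s m j"])
          (use A' A that in auto)
      also have "\<dots> = (\<Sum>m\<in>A'. (z l powi (e k - m)) *\<^sub>C s m j)"
        by (rule sum.mono_neutral_left) (use A' A in auto)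
      also have "\<dots> = (z l powi e k) *\<^sub>C sh l j"
        by (simp add: sh_def scaleC_sum_right scaleC_scaleC z0 power_int_diff power_int_minus
            divide_inverse)
      finally show ?thesis .
    qed
    have "th l i = (\<Sum>m\<in>A'. \<Sum>j<n. \<Sum>k\<le>d. F i j k *\<^sub>C (z l powi (- m)) *\<^sub>C s (m + e k) j)"
      by (simp add: th_def t_def scaleC_sum_right scaleC_scaleC mult.commute)
    also have "\<dots> = (\<Sum>j<n. \<Sum>m\<in>A'. \<Sum>k\<le>d. F i j k *\<^sub>C (z l powi (- m)) *\<^sub>C s (m + e k) j)"
      by (rule sum.swap)
    also have "\<dots> = (\<Sum>j<n. \<Sum>k\<le>d. \<Sum>m\<in>A'. F i j k *\<^sub>C (z l powi (- m)) *\<^sub>C s (m + e k) j)"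
      by (rule sum.cong [OF refl], rule sum.swap)
    also have "\<dots> = (\<Sum>j<n. \<Sum>k\<le>d. F i j k *\<^sub>C (z l powi e k) *\<^sub>C sh l j)"
      by (intro sum.cong refl) (simp add: scaleC_sum_right [symmetric] shift)
    finally show ?thesis by (simp add: scaleC_sum_left scaleC_scaleC)
  qed
  have pointwise: "(\<Sum>i<n. Q (th l i)) \<le> M * (\<Sum>j<n. Q (sh l j))" for l
    unfolding symbol by (rule matrix_amplification, rule F) (simp add: z_def)
  have "real L * (\<Sum>m\<in>A'. \<Sum>i<n. Q (t m i)) = (\<Sum>i<n. real L * (\<Sum>m\<in>A'. Q (t m i)))"
    by (subst sum.swap) (simp add: sum_distrib_left)
  also have "\<dots> = (\<Sum>i<n. \<Sum>l<L. Q (th l i))"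
    by (intro sum.cong refl)
      (simp only: th_def z_def parseval [OF A'(1) L Lpos])
  also have "\<dots> = (\<Sum>l<L. \<Sum>i<n. Q (th l i))" by (rule sum.swap)
  also have "\<dots> \<le> (\<Sum>l<L. M * (\<Sum>j<n. Q (sh l j)))" by (intro sum_mono pointwise)
  also have "\<dots> = M * (\<Sum>j<n. \<Sum>l<L. Q (sh l j))"
    by (subst sum.swap) (simp add: sum_distrib_left)
  also have "\<dots> = M * (\<Sum>j<n. real L * (\<Sum>m\<in>A'. Q (s m j)))"
    by (simp only: sh_def z_def parseval [OF A'(1) L Lpos])
  also have "\<dots> = real L * (M * (\<Sum>m\<in>A'. \<Sum>j<n. Q (s m j)))"
    by (subst sum.swap) (simp add: sum_distrib_left mult_ac)
  finally have "(\<Sum>m\<in>A'. \<Sum>i<n. Q (t m i)) \<le> M * (\<Sum>m\<in>A'. \<Sum>j<n. Q (s m j))"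
    using Lpos by simp
  moreover have "(\<Sum>m\<in>C. \<Sum>i<n. Q (t m i)) \<le> (\<Sum>m\<in>A'. \<Sum>i<n. Q (t m i))"
    by (rule sum_mono2) (use A' in \<open>auto intro: sum_nonneg\<close>)
  moreover have "(\<Sum>m\<in>A'. \<Sum>j<n. Q (s m j)) = (\<Sum>m\<in>A. \<Sum>j<n. Q (s m j))"
    by (rule sum.mono_neutral_right) (use A A' in auto)
  ultimately show ?thesis by (simp add: t_def)
qed

text \<open>
  Passing from \<open>s m\<close> to \<open>s m / \<rho>\<^sup>m\<close> turns the circle of radius \<open>\<rho>\<close> into the unit circle.
\<close>

lemma weighted_convolution_bound:
  fixes F :: "nat \<Rightarrow> nat \<Rightarrow> nat \<Rightarrow> complex" and e :: "nat \<Rightarrow> int" and s :: "int \<Rightarrow> nat \<Rightarrow> 'a"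
  assumes rho: "\<rho> > 0"
    and F: "\<And>z v. cmod z = \<rho> \<Longrightarrow>
      (\<Sum>i<n. (cmod (\<Sum>j<n. (\<Sum>k\<le>d. F i j k * z powi e k) * v j))\<^sup>2)
        \<le> M * (\<Sum>j<n. (cmod (v j))\<^sup>2)"
    and A: "finite A" "\<And>m j. m \<notin> A \<Longrightarrow> s m j = 0" and C: "finite C"
  shows "(\<Sum>m\<in>C. \<rho> powi (- 2 * m) * (\<Sum>i<n. Q (\<Sum>j<n. \<Sum>k\<le>d. F i j k *\<^sub>C s (m + e k) j)))
    \<le> M * (\<Sum>m\<in>A. \<rho> powi (- 2 * m) * (\<Sum>j<n. Q (s m j)))"
proof -
  let ?\<rho> = "of_real \<rho> :: complex"
  have \<rho>0: "?\<rho> \<noteq> 0" using rho by simp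
  define s' where "s' m j = (?\<rho> powi (- m)) *\<^sub>C s m j" for m j
  define F' where "F' i j k = F i j k * ?\<rho> powi e k" for i j k
  have weight: "Q ((?\<rho> powi (- m)) *\<^sub>C x) = \<rho> powi (- 2 * m) * Q x" for m x
  proof -
    have "cmod (?\<rho> powi (- m)) = \<rho> powi (- m)"
      using rho by (simp only: norm_power_int norm_of_real abs_of_pos)
    moreover have "\<rho> powi (- 2 * m) = (\<rho> powi (- m)) ^ 2"
      using power_int_mult [of \<rho> "- m" "int 2"] by (simp only: power_int_of_nat) (simp add: mult.commute)
    ultimately have "(cmod (?\<rho> powi (- m)))\<^sup>2 = \<rho> powi (- 2 * m)"
      by simp
    then show ?thesis by (simp add: Q_scale)
  qed
  have shift: "F' i j k *\<^sub>C s' (m + e k) j = (?\<rho> powi (- m)) *\<^sub>C F i j k *\<^sub>C s (m + e k) j" for i j k m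
  proof -
    have "?\<rho> powi e k * ?\<rho> powi (- (m + e k)) = ?\<rho> powi (- m)"
      using \<rho>0 by (subst power_int_add [symmetric]) auto
    then show ?thesis
      by (simp add: F'_def s'_def scaleC_scaleC mult.commute mult.left_commute)
  qed
  have "(\<Sum>m\<in>C. \<Sum>i<n. Q (\<Sum>j<n. \<Sum>k\<le>d. F' i j k *\<^sub>C s' (m + e k) j))
    \<le> M * (\<Sum>m\<in>A. \<Sum>j<n. Q (s' m j))"
  proof (rule convolution_bound [OF _ A(1) _ C])
    fix z :: complex and v :: "nat \<Rightarrow> complex" assume "cmod z = 1"
    then have "cmod (?\<rho> * z) = \<rho>" using rho by (simp add: norm_mult)
    from F [OF this, of v] show
      "(\<Sum>i<n. (cmod (\<Sum>j<n. (\<Sum>k\<le>d. F' i j k * z powi e k) * v j))\<^sup>2)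
        \<le> M * (\<Sum>j<n. (cmod (v j))\<^sup>2)"
      by (simp add: F'_def power_int_mult_distrib mult.assoc)
  qed (simp add: s'_def A)
  then show ?thesis
    unfolding shift scaleC_sum_right [symmetric] unfolding s'_def weight
    by (simp add: sum_distrib_left)
qed

end

section \<open>Riesz representation and adjoints\<close>

interpretation cinner: psd_form cinner
  rewrites "psd_form.Q cinner = (\<lambda>x. (norm x)\<^sup>2)"
proof -
  show 1: "psd_form (cinner :: 'a \<Rightarrow> 'a \<Rightarrow> complex)"
  proof
    show "cinner x y = cnj (cinner y x)" for x y :: 'a by (rule cinner_commute)
    show "0 \<le> Re (cinner x x)" for x :: 'a by (simp only: cinner_norm Re_complex_of_real) simp
  qed (simp_all add: cinner_add_left cinner_scaleC_left)
  show "psd_form.Q cinner = (\<lambda>x::'a. (norm x)\<^sup>2)"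
    by (rule ext, simp only: psd_form.Q_def [OF 1] cinner_norm Re_complex_of_real)
qed

lemma cauchy_schwarz: "cmod (cinner x y) \<le> norm x * norm (y::'a::complex_inner)"
proof (cases "y = 0")
  case False
  define b where "b = cinner x y"
  define N where "N = (norm y)\<^sup>2"
  have N: "N > 0" using False by (simp add: N_def)
  define u where "u = (- (b / of_real N)) *\<^sub>C y"
  have "0 \<le> (norm (x + u))\<^sup>2" by simp
  also have "\<dots> = (norm x)\<^sup>2 + (norm u)\<^sup>2 + 2 * Re (cinner x u)" by (rule cinner.Q_add)
  also have "(norm u)\<^sup>2 = (cmod b)\<^sup>2 / N"
    using N unfolding u_def cinner.Q_scale N_def [symmetric]
    by (simp add: norm_divide power_divide power2_eq_square)
  also have "Re (cinner x u) = - (cmod b)\<^sup>2 / N"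
  proof -
    have "cinner x u = - of_real ((cmod b)\<^sup>2) / of_real N"
      unfolding complex_norm_square by (simp add: u_def cinner.scale_right b_def mult.commute)
    also have "\<dots> = of_real (- (cmod b)\<^sup>2 / N)" by simp
    finally show ?thesis by (simp only: Re_complex_of_real)
  qed
  finally have "(cmod b)\<^sup>2 / N \<le> (norm x)\<^sup>2" by simp
  then have "(cmod b)\<^sup>2 \<le> (norm x)\<^sup>2 * N" using N by (simp only: pos_divide_le_eq)
  then have "(cmod b)\<^sup>2 \<le> (norm x * norm y)\<^sup>2" by (simp add: N_def power_mult_distrib)
  then show ?thesis unfolding b_def by (rule power2_le_imp_le) simp
qed simp

text \<open>
  The representing vector is the minimiser of \<open>q x = |x|\<^sup>2 - 2 Re (\<phi> x)\<close>. By the parallelogram law a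
  minimising sequence is Cauchy, and the first variation of \<open>q\<close> at the minimiser vanishes.
\<close>

lemma riesz_representation:
  fixes \<phi> :: "'a::chilbert_space \<Rightarrow> complex"
  assumes add: "\<And>x y. \<phi> (x + y) = \<phi> x + \<phi> y" and scale: "\<And>a x. \<phi> (a *\<^sub>C x) = a * \<phi> x"
    and bound: "\<And>x. cmod (\<phi> x) \<le> C * norm x"
  shows "\<exists>y. \<forall>x. \<phi> x = cinner x y"
proof -
  define q where "q x = (norm x)\<^sup>2 - 2 * Re (\<phi> x)" for x
  have q_add: "q (x + h) = q x + (norm h)\<^sup>2 + 2 * Re (cinner x h) - 2 * Re (\<phi> h)" for x h
    by (simp add: q_def cinner.Q_add add)
  have q_lower: "- C\<^sup>2 \<le> q x" for x
  proof -
    have "Re (\<phi> x) \<le> C * norm x" using bound [of x] complex_Re_le_cmod [of "\<phi> x"] by linarith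
    moreover have "0 \<le> (norm x - C)\<^sup>2" by simp
    ultimately show ?thesis by (simp add: q_def power2_diff mult_ac)
  qed
  define I where "I = Inf (range q)"
  have I_le: "I \<le> q x" for x
    unfolding I_def by (rule cInf_lower) (auto intro!: bdd_belowI2 q_lower)
  have "\<exists>x. q x < I + inverse (real (Suc k))" for k
    using cInf_lessD [of "range q" "I + inverse (real (Suc k))"] by (auto simp: I_def)
  then obtain X where X: "\<And>k. q (X k) < I + inverse (real (Suc k))" by metis
  have parallelogram: "(norm (x - y))\<^sup>2 = 2 * q x + 2 * q y - 4 * q ((1/2) *\<^sub>C (x + y))" for x y
  proof -
    have "(norm (x - y))\<^sup>2 = (norm x)\<^sup>2 + (norm y)\<^sup>2 - 2 * Re (cinner x y)"
      using cinner.Q_add [of x "- y"] cinner.scale_right [of x "- 1" y]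
      by (simp add: scaleC_minus_left)
    moreover have "4 * q ((1/2) *\<^sub>C (x + y)) = (norm (x + y))\<^sup>2 - 4 * Re (\<phi> (x + y))"
      by (simp add: q_def cinner.Q_scale scale power_divide norm_divide)
    ultimately show ?thesis by (simp add: q_def cinner.Q_add add)
  qed
  have close: "(norm (X k - X l))\<^sup>2 \<le> 2 * inverse (real (Suc k)) + 2 * inverse (real (Suc l))" for k l
    using X [of k] X [of l] I_le [of "(1/2) *\<^sub>C (X k + X l)"] parallelogram [of "X k" "X l"]
    by linarith
  have "Cauchy X"
  proof (rule metric_CauchyI)
    fix \<epsilon> :: real assume \<epsilon>: "\<epsilon> > 0"
    then obtain n where n: "inverse (real (Suc n)) < \<epsilon>\<^sup>2 / 4"
      using reals_Archimedean [of "\<epsilon>\<^sup>2 / 4"] by auto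
    show "\<exists>M. \<forall>m\<ge>M. \<forall>n\<ge>M. dist (X m) (X n) < \<epsilon>"
    proof (intro exI allI impI)
      fix k l assume kl: "n \<le> k" "n \<le> l"
      then have "inverse (real (Suc k)) \<le> inverse (real (Suc n))"
        "inverse (real (Suc l)) \<le> inverse (real (Suc n))"
        by (auto intro!: le_imp_inverse_le)
      with close [of k l] n have "(norm (X k - X l))\<^sup>2 < \<epsilon>\<^sup>2" by linarith
      then have "norm (X k - X l) < \<epsilon>"
        by (rule power2_less_imp_less) (use \<epsilon> in simp)
      then show "dist (X k) (X l) < \<epsilon>" by (simp add: dist_norm)
    qed
  qed
  then obtain y where y: "X \<longlonglongrightarrow> y"
    by (auto simp: Cauchy_convergent_iff convergent_def)
  have q_y: "q y \<le> q x" for x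
  proof -
    have lin: "bounded_linear (\<lambda>x. Re (\<phi> x))"
    proof (rule bounded_linear_intro [where K = C])
      show "Re (\<phi> (t *\<^sub>R x)) = t *\<^sub>R Re (\<phi> x)" for t x
        by (simp add: scaleC_of_real [symmetric] scale)
      show "norm (Re (\<phi> x)) \<le> norm x * C" for x
        using bound [of x] abs_Re_le_cmod [of "\<phi> x"] by (simp add: mult.commute)
    qed (simp add: add)
    have "(\<lambda>k. q (X k)) \<longlonglongrightarrow> q y"
      unfolding q_def by (intro tendsto_intros bounded_linear.tendsto [OF lin] y)
    moreover have "(\<lambda>k. I + inverse (real (Suc k))) \<longlonglongrightarrow> I + 0"
      by (intro tendsto_intros LIMSEQ_inverse_real_of_nat)
    ultimately have "q y \<le> I + 0"
      by (rule LIMSEQ_le) (use X in \<open>auto intro: less_imp_le\<close>)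
    then show ?thesis using I_le [of x] by simp
  qed
  have Re_eq: "Re (\<phi> h) = Re (cinner h y)" for h
  proof -
    define b where "b = Re (cinner y h) - Re (\<phi> h)"
    define N where "N = (norm h)\<^sup>2 + 1"
    have N: "N > 0" by (simp add: N_def add_nonneg_pos)
    \<comment> \<open>almost the minimiser of the quadratic polynomial in \<open>t\<close> below; the 1 in \<open>N\<close> covers \<open>h = 0\<close>\<close>
    define t where "t = - b / N"
    have "0 \<le> q (y + of_real t *\<^sub>C h) - q y" using q_y by simp
    also have "\<dots> = t\<^sup>2 * (norm h)\<^sup>2 + 2 * t * b"
      by (simp add: q_add cinner.Q_scale cinner.scale_right scale b_def algebra_simps)
    also have "\<dots> \<le> t\<^sup>2 * N + 2 * t * b"
      by (simp add: N_def distrib_left)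
    also have "\<dots> = - (b\<^sup>2 / N)"
      using N by (simp add: t_def power2_eq_square field_simps)
    finally have "b\<^sup>2 \<le> 0" using N by (simp add: field_simps)
    then have "b = 0" by simp
    moreover have "Re (cinner y h) = Re (cnj (cinner h y))" by (rule arg_cong [OF cinner_commute])
    ultimately show ?thesis by (simp add: b_def)
  qed
  have "\<phi> x = cinner x y" for x
  proof (rule complex_eqI [OF Re_eq])
    show "Im (\<phi> x) = Im (cinner x y)"
      using Re_eq [of "\<i> *\<^sub>C x"] by (simp add: scale cinner_scaleC_left)
  qed
  then show ?thesis by blast
qed

lemma cadjoint:
  fixes T :: "'a::chilbert_space \<Rightarrow> 'a"
  assumes "bounded_clinear T"
  shows "cinner (T x) y = cinner x (cadjoint T y)"
proof -
  obtain K where K: "\<And>x. norm (T x) \<le> norm x * K"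
    using bounded_linear.bounded [OF bounded_clinearD(1) [OF assms]] by blast
  have "\<exists>s. \<forall>x. cinner (T x) y = cinner x s" for y
  proof (rule riesz_representation [where C = "K * norm y"])
    show "cmod (cinner (T x) y) \<le> K * norm y * norm x" for x
      using cauchy_schwarz [of "T x" y] mult_right_mono [OF K [of x], of "norm y"]
      by (simp add: mult_ac)
  qed (simp_all add: bounded_clinearD [OF assms] cinner_add_left cinner_scaleC_left)
  then obtain A where A: "\<And>x y. cinner (T x) y = cinner x (A y)" by metis
  have "cadjoint T = A"
    unfolding cadjoint_def
  proof (rule the_equality)
    fix A' assume A': "\<forall>x y. cinner (T x) y = cinner x (A' y)"
    have "A' y = A y" for y
    proof -
      have "cinner x (A' y + (- 1) *\<^sub>C A y) = 0" for x
        using A [of x y] A' unfolding cinner.add_right cinner.scale_right by simp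
      then have "(norm (A' y + (- 1) *\<^sub>C A y))\<^sup>2 = 0"
        by (metis cinner_norm of_real_eq_0_iff)
      then show ?thesis by (simp add: scaleC_minus_left)
    qed
    then show "A' = A" by blast
  qed (use A in blast)
  then show ?thesis by (simp add: A)
qed


section \<open>The energy identity along an orbit\<close>

text \<open>
  The hypothesis on \<open>T\<close> in terms of norms, together with the inverse \<open>S\<close> of \<open>T\<close>.
\<close>

locale annulus_operator =
  fixes T S :: "'a::chilbert_space \<Rightarrow> 'a" and r :: real
  assumes r: "0 < r" "r < 1"
    and T: "bounded_clinear T" and S: "bounded_clinear S"
    and ST [simp]: "S (T x) = x" and TS [simp]: "T (S x) = x"
    and defect: "(norm (T (T x)))\<^sup>2 + r\<^sup>2 * (norm x)\<^sup>2 \<le> (1 + r\<^sup>2) * (norm (T x))\<^sup>2"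
begin

definition Tp :: "int \<Rightarrow> 'a \<Rightarrow> 'a"
  where "Tp m = (if m \<ge> 0 then T ^^ nat m else S ^^ nat (- m))"

lemma Tp_clinear: "bounded_clinear (Tp m)"
  by (simp add: Tp_def bounded_clinear_funpow T S)

lemmas Tp_simps = bounded_clinearD [OF Tp_clinear]

lemma Tp_0 [simp]: "Tp 0 x = x"
  by (simp add: Tp_def)

lemma T_Tp: "T (Tp m x) = Tp (m + 1) x"
proof (cases "m \<ge> 0")
  case True
  then have "nat (m + 1) = Suc (nat m)" by simp
  with True show ?thesis by (simp add: Tp_def)
next
  case False
  then have "nat (- m) = Suc (nat (- (m + 1)))" by simp
  with False show ?thesis by (simp add: Tp_def)
qed

lemma S_Tp: "S (Tp m x) = Tp (m - 1) x"
  using T_Tp [of "m - 1" x] by (metis ST diff_add_cancel)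

lemma Tp_add: "Tp m (Tp k x) = Tp (m + k) x"
proof (induction m rule: int_induct [where k = 0])
  case base
  then show ?case by simp
next
  case (step1 i)
  have "Tp (i + 1) (Tp k x) = T (Tp i (Tp k x))" by (simp add: T_Tp)
  with step1 show ?case by (simp add: T_Tp algebra_simps)
next
  case (step2 i)
  have "Tp (i - 1) (Tp k x) = S (Tp i (Tp k x))" by (simp add: S_Tp)
  with step2 show ?case by (simp add: S_Tp algebra_simps)
qed

text \<open>
  The diagonals of the three forms are \<open>d\<close>, the defect that is nonnegative by hypothesis, and the two
  first order differences \<open>e\<close> and \<open>c\<close> which remain when the root \<open>1\<close>, respectively \<open>r\<^sup>2\<close>, of the
  second order recursion is split off.
\<close>

definition d_form :: "'a \<Rightarrow> 'a \<Rightarrow> complex"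
  where "d_form x y = of_real (1 + r\<^sup>2) * cinner (T x) (T y) - of_real (r\<^sup>2) * cinner x y
    - cinner (T (T x)) (T (T y))"

definition e_form :: "'a \<Rightarrow> 'a \<Rightarrow> complex"
  where "e_form x y = cinner (T x) (T y) - of_real (r\<^sup>2) * cinner x y"

definition c_form :: "'a \<Rightarrow> 'a \<Rightarrow> complex"
  where "c_form x y = cinner x y - cinner (T x) (T y)"

text \<open>
  The form \<open>e\<close> decreases along forward orbits. If it were negative somewhere, the squared norms would
  decrease at least linearly in the forward direction, and so become negative.
\<close>

lemma outer_expansion: "r\<^sup>2 * (norm x)\<^sup>2 \<le> (norm (T x))\<^sup>2"
proof (rule ccontr)
  define \<epsilon> where "\<epsilon> = r\<^sup>2 * (norm x)\<^sup>2 - (norm (T x))\<^sup>2"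
  assume "\<not> ?thesis"
  then have \<epsilon>: "\<epsilon> > 0" unfolding \<epsilon>_def by linarith
  have step: "(norm (Tp (int n + 1) x))\<^sup>2 \<le> r\<^sup>2 * (norm (Tp (int n) x))\<^sup>2 - \<epsilon>" for n
  proof (induction n)
    case 0
    then show ?case by (simp add: \<epsilon>_def T_Tp [of 0, symmetric, simplified])
  next
    case (Suc n)
    then show ?case using defect [of "Tp (int n) x"]
      by (simp add: T_Tp algebra_simps)
  qed
  have "(norm (Tp (int n) x))\<^sup>2 \<le> (norm x)\<^sup>2 - real n * \<epsilon>" for n
  proof (induction n)
    case (Suc n)
    have "r\<^sup>2 * (norm (Tp (int n) x))\<^sup>2 \<le> 1 * (norm (Tp (int n) x))\<^sup>2"
      using r by (intro mult_right_mono) (auto simp: power_le_one)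
    with step [of n] Suc show ?case by (simp add: algebra_simps)
  qed simp
  then have "real n * \<epsilon> \<le> (norm x)\<^sup>2" for n
    by (smt (verit) zero_le_power2)
  with \<epsilon> show False
    using reals_Archimedean3 [OF \<epsilon>] by (meson not_less)
qed

text \<open>
  The mirror image of the previous lemma: \<open>c\<close> satisfies \<open>r\<^sup>2 c(y) \<le> c(T y)\<close>, so that a negative value would
  persist along the backward orbit and drive the squared norms below zero.
\<close>

lemma contraction: "(norm (T x))\<^sup>2 \<le> (norm x)\<^sup>2"
proof (rule ccontr)
  define \<epsilon> where "\<epsilon> = (norm (T x))\<^sup>2 - (norm x)\<^sup>2"
  assume "\<not> ?thesis"
  then have \<epsilon>: "\<epsilon> > 0" unfolding \<epsilon>_def by linarith
  have step: "(norm (Tp (- int n) x))\<^sup>2 \<le> (norm (Tp (1 - int n) x))\<^sup>2 - \<epsilon>" for n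
  proof (induction n)
    case 0
    then show ?case by (simp add: \<epsilon>_def T_Tp [of 0, symmetric, simplified])
  next
    case (Suc n)
    let ?y = "Tp (- 1 - int n) x"
    let ?g = "(norm (T ?y))\<^sup>2 - (norm ?y)\<^sup>2"
    have "\<epsilon> \<le> (norm (T (T ?y)))\<^sup>2 - (norm (T ?y))\<^sup>2"
      using Suc by (simp add: T_Tp algebra_simps)
    also have "\<dots> \<le> r\<^sup>2 * ?g"
      using defect [of ?y] by (simp add: algebra_simps)
    finally have le: "\<epsilon> \<le> r\<^sup>2 * ?g" .
    then have pos: "0 < ?g" using \<epsilon> r by (meson zero_less_mult_pos less_le_trans zero_less_power)
    have "r\<^sup>2 * ?g \<le> 1 * ?g"
    proof (rule mult_right_mono)
      show "r\<^sup>2 \<le> 1" using r by (simp add: power_le_one)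
    qed (rule less_imp_le [OF pos])
    with le show ?case by (simp add: T_Tp algebra_simps)
  qed
  have "(norm (Tp (1 - int n) x))\<^sup>2 \<le> (norm (T x))\<^sup>2 - real n * \<epsilon>" for n
  proof (induction n)
    case 0
    then show ?case by (simp add: T_Tp [of 0, symmetric, simplified])
  next
    case (Suc n)
    with step [of n] show ?case by (simp add: algebra_simps)
  qed
  then have "real n * \<epsilon> \<le> (norm (T x))\<^sup>2" for n
    by (smt (verit) zero_le_power2)
  with \<epsilon> show False
    using reals_Archimedean3 [OF \<epsilon>] by (meson not_less)
qed

lemma norm_T_le: "norm (T x) \<le> norm x"
  using contraction [of x] by (rule power2_le_imp_le) simp

lemma norm_S_le: "norm (S x) \<le> norm x / r"
proof -
  have "(r * norm (S x))\<^sup>2 \<le> (norm x)\<^sup>2"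
    using outer_expansion [of "S x"] by (simp add: power_mult_distrib)
  then have "r * norm (S x) \<le> norm x" by (rule power2_le_imp_le) simp
  then show ?thesis using r by (simp add: field_simps)
qed

lemmas form_simps = bounded_clinearD [OF T] cinner_add_left cinner_scaleC_left

lemma d_form_self: "Re (d_form x x) = (1 + r\<^sup>2) * (norm (T x))\<^sup>2 - r\<^sup>2 * (norm x)\<^sup>2 - (norm (T (T x)))\<^sup>2"
  unfolding d_form_def cinner_norm of_real_mult [symmetric] of_real_diff [symmetric] by (rule Re_complex_of_real)

lemma e_form_self: "Re (e_form x x) = (norm (T x))\<^sup>2 - r\<^sup>2 * (norm x)\<^sup>2"
  unfolding e_form_def cinner_norm of_real_mult [symmetric] of_real_diff [symmetric] by (rule Re_complex_of_real)

lemma c_form_self: "Re (c_form x x) = (norm x)\<^sup>2 - (norm (T x))\<^sup>2"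
  unfolding c_form_def cinner_norm of_real_mult [symmetric] of_real_diff [symmetric] by (rule Re_complex_of_real)

sublocale d: psd_form d_form
proof
  show "d_form x y = cnj (d_form y x)" for x y
    unfolding d_form_def complex_cnj_diff complex_cnj_mult complex_cnj_complex_of_real
    by (simp only: cinner_commute [symmetric])
  show "0 \<le> Re (d_form x x)" for x
    using defect [of x] by (simp add: d_form_self)
qed (simp_all add: d_form_def form_simps algebra_simps)

sublocale e: psd_form e_form
proof
  show "e_form x y = cnj (e_form y x)" for x y
    unfolding e_form_def complex_cnj_diff complex_cnj_mult complex_cnj_complex_of_real
    by (simp only: cinner_commute [symmetric])
  show "0 \<le> Re (e_form x x)" for x
    using outer_expansion [of x] by (simp add: e_form_self)
qed (simp_all add: e_form_def form_simps algebra_simps)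

sublocale c: psd_form c_form
proof
  show "c_form x y = cnj (c_form y x)" for x y
    unfolding c_form_def complex_cnj_diff
    by (simp only: cinner_commute [symmetric])
  show "0 \<le> Re (c_form x x)" for x
    using contraction [of x] by (simp add: c_form_self)
qed (simp_all add: c_form_def form_simps algebra_simps)

lemma d_eq_e: "d.Q x = e.Q x - e.Q (T x)"
  by (simp add: d.Q_def e.Q_def d_form_self e_form_self algebra_simps)

lemma d_eq_c: "d.Q x = c.Q (T x) - r\<^sup>2 * c.Q x"
  by (simp add: d.Q_def c.Q_def d_form_self c_form_self algebra_simps)

lemma e_plus_c: "e.Q x + c.Q x = (1 - r\<^sup>2) * (norm x)\<^sup>2"
  by (simp add: e.Q_def c.Q_def e_form_self c_form_self algebra_simps)

end

context annulus_operator
begin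

text \<open>
  The Green function of the recursion, up to a constant factor. The shift by one in the exponent comes from
  writing the defect as a second difference that starts, instead of being centred, at \<open>m\<close>.
\<close>

definition weight :: "int \<Rightarrow> real"
  where "weight m = (if 0 \<le> m then 1 else r powi (- 2 * (m + 1)))"

lemma weight_nonneg: "0 \<le> weight m"
  using r by (simp add: weight_def)

lemma powi_r_le_1: "0 \<le> m \<Longrightarrow> r powi m \<le> 1"
  using r by (simp add: power_int_le_one)

lemma weight_le_1: "weight m \<le> 1"
  unfolding weight_def using powi_r_le_1 [of "- 2 * (m + 1)"] by auto

lemma weight_le_powi: "weight m \<le> r powi (- 2 * (m + 1))"
proof (cases "0 \<le> m")
  case True
  have "1 \<le> inverse (r powi (2 * (m + 1)))"
    using r powi_r_le_1 [of "2 * (m + 1)"] True by (intro one_le_inverse) auto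
  also have "\<dots> = r powi (- 2 * (m + 1))"
    using power_int_minus [of r "2 * (m + 1)"] by (simp only: minus_mult_left)
  finally show ?thesis using True by (simp only: weight_def if_True)
qed (simp add: weight_def)

text \<open>
  On \<open>m \<ge> 0\<close> the sum telescopes because \<open>d(y) = e(y) - e(T y)\<close>, on \<open>m < 0\<close> because
  \<open>d(y) = c(T y) - r\<^sup>2 c(y)\<close>; what remains at \<open>m = 0\<close> is \<open>e(x) + c(x) = (1 - r\<^sup>2)|x|\<^sup>2\<close>.
\<close>

lemma energy_identity:
  "(1 - r\<^sup>2) * (norm x)\<^sup>2 = (\<Sum>m\<in>{- int N..<int N}. weight m * d.Q (Tp m x))
    + e.Q (Tp (int N) x) + r powi (2 * int N) * c.Q (Tp (- int N) x)"
proof (induction N)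
  case 0
  show ?case by (simp add: e_plus_c)
next
  case (Suc N)
  let ?f = "\<lambda>m. weight m * d.Q (Tp m x)"
  have split: "{- int (Suc N)..<int (Suc N)} = insert (- 1 - int N) (insert (int N) {- int N..<int N})"
    by auto
  have "(\<Sum>m\<in>{- int (Suc N)..<int (Suc N)}. ?f m) =
      ?f (- 1 - int N) + ?f (int N) + (\<Sum>m\<in>{- int N..<int N}. ?f m)"
    unfolding split by simp
  moreover have "?f (int N) = e.Q (Tp (int N) x) - e.Q (Tp (int (Suc N)) x)"
    by (simp add: weight_def d_eq_e T_Tp add.commute)
  moreover have "?f (- 1 - int N) = r powi (2 * int N) * c.Q (Tp (- int N) x) -
      r powi (2 * int (Suc N)) * c.Q (Tp (- int (Suc N)) x)"
  proof -
    have "r powi (2 * int (Suc N)) = r powi (2 * int N) * r\<^sup>2"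
      using power_int_add [of r "2 * int N" 2] r by (simp add: algebra_simps)
    then show ?thesis by (simp add: weight_def d_eq_c T_Tp algebra_simps)
  qed
  ultimately show ?case using Suc by simp
qed

end

section \<open>The estimate for matrices of Laurent polynomials\<close>

text \<open>
  Both sums range over windows whose lengths differ by the constant \<open>2 c\<close>. For long windows this difference
  is negligible, so the comparison of sums passes to the limits without loss in the constant \<open>C\<close>.
\<close>

lemma cesaro_comparison:
  fixes \<phi> \<psi> :: "int \<Rightarrow> real"
  assumes phi: "\<And>m. \<phi> (m + 1) \<le> \<phi> m" "(\<lambda>N. \<phi> (int N)) \<longlonglongrightarrow> \<Phi>"
    and psi: "\<And>m. \<psi> (m + 1) \<le> \<psi> m" "(\<lambda>N. \<psi> (int N)) \<longlonglongrightarrow> \<Psi>"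
    and C: "C \<ge> 0"
    and sums: "\<And>a b. (\<Sum>m=a..b. \<phi> m) \<le> C * (\<Sum>m=a - int c..b + int c. \<psi> m)"
  shows "\<Phi> \<le> C * \<Psi>"
proof -
  have anti: "f b \<le> f a" if "a \<le> b" and "\<And>m. f (m + 1) \<le> f m" for a b :: int and f :: "int \<Rightarrow> real"
    using that(1)
  proof (induction b rule: int_ge_induct)
    case base
    show ?case by simp
  next
    case (step b)
    from that(2) [of b] step.IH show ?case by linarith
  qed
  note anti_phi = anti [of _ _ \<phi>, OF _ phi(1)] and anti_psi = anti [of _ _ \<psi>, OF _ psi(1)]
  have lim_le: "\<Phi> \<le> \<phi> m" for m
  proof (rule LIMSEQ_le_const2 [OF phi(2)], intro exI allI impI)
    fix N assume "nat m \<le> N"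
    then show "\<phi> (int N) \<le> \<phi> m" by (intro anti_phi) simp
  qed
  have bound: "\<Phi> \<le> C * \<psi> (int N)" for N
  proof (rule LIMSEQ_le_const)
    show "(\<lambda>L. C * (\<psi> (int N) + 2 * real c * \<psi> (int N) * inverse (real (Suc L))))
        \<longlonglongrightarrow> C * \<psi> (int N)"
    proof -
      have "(\<lambda>L. C * (\<psi> (int N) + 2 * real c * \<psi> (int N) * inverse (real (Suc L))))
        \<longlonglongrightarrow> C * (\<psi> (int N) + 2 * real c * \<psi> (int N) * 0)"
        by (intro tendsto_intros LIMSEQ_inverse_real_of_nat)
      then show ?thesis by simp
    qed
    show "\<exists>L0. \<forall>L\<ge>L0. \<Phi> \<le> C * (\<psi> (int N) + 2 * real c * \<psi> (int N) * inverse (real (Suc L)))"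
    proof (intro exI allI impI)
      fix L :: nat
      let ?a = "int N + int c" and ?b = "int N + int c + int L"
      have "real (Suc L) * \<Phi> = (\<Sum>m=?a..?b. \<Phi>)" by simp
      also have "\<dots> \<le> (\<Sum>m=?a..?b. \<phi> m)" by (intro sum_mono lim_le)
      also have "\<dots> \<le> C * (\<Sum>m=?a - int c..?b + int c. \<psi> m)" by (rule sums)
      also have "\<dots> \<le> C * (\<Sum>m=?a - int c..?b + int c. \<psi> (int N))"
        by (intro mult_left_mono [OF _ C] sum_mono anti_psi) auto
      also have "\<dots> = C * (real (Suc L + 2 * c) * \<psi> (int N))"
      proof -
        have "nat (?b + int c - (?a - int c) + 1) = Suc L + 2 * c" by simp
        then show ?thesis by simp
      qed
      also have "\<dots> = real (Suc L) * (C * (\<psi> (int N) + 2 * real c * \<psi> (int N) * inverse (real (Suc L))))"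
        by (simp add: field_simps)
      finally show "\<Phi> \<le> C * (\<psi> (int N) + 2 * real c * \<psi> (int N) * inverse (real (Suc L)))"
        by (simp only: mult_le_cancel_left_pos of_nat_0_less_iff zero_less_Suc)
    qed
  qed
  show ?thesis
    by (rule LIMSEQ_le_const [OF tendsto_mult_left [OF psi(2)]]) (use bound in auto)
qed


context annulus_operator
begin

lemma e_T_le: "e.Q (T x) \<le> e.Q x"
  using d_eq_e [of x] d.Q_nonneg [of x] by linarith

lemma c_T_ge: "r\<^sup>2 * c.Q x \<le> c.Q (T x)"
  using d_eq_c [of x] d.Q_nonneg [of x] by linarith

text \<open>
  For \<open>m\<close> in the window, \<open>Tp m (y i)\<close> depends only on the part of the orbit of \<open>x\<close> in the window
  enlarged by \<open>c\<close>. Truncating the orbit there gives a finitely supported sequence, to which the bound for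
  convolutions applies. This controls the boundary terms of the energy identity.
\<close>

lemma orbit_window_bound:
  fixes F :: "nat \<Rightarrow> nat \<Rightarrow> nat \<Rightarrow> complex" and p :: "nat \<Rightarrow> int" and x :: "nat \<Rightarrow> 'a"
  assumes B: "psd_form B" and rho: "\<rho> > 0"
    and F: "\<And>z v. cmod z = \<rho> \<Longrightarrow>
      (\<Sum>i<n. (cmod (\<Sum>j<n. (\<Sum>k\<le>deg. F i j k * z powi p k) * v j))\<^sup>2)
        \<le> M * (\<Sum>j<n. (cmod (v j))\<^sup>2)"
    and p: "\<And>k. k \<le> deg \<Longrightarrow> \<bar>p k\<bar> \<le> int c"
    and y: "\<And>i. y i = (\<Sum>j<n. \<Sum>k\<le>deg. F i j k *\<^sub>C Tp (p k) (x j))"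
  shows "(\<Sum>m=a..b. \<rho> powi (- 2 * m) * (\<Sum>i<n. psd_form.Q B (Tp m (y i))))
    \<le> M * (\<Sum>m=a - int c..b + int c. \<rho> powi (- 2 * m) * (\<Sum>j<n. psd_form.Q B (Tp m (x j))))"
proof -
  interpret psd_form B by (rule B)
  let ?A = "{a - int c..b + int c}"
  define s where "s m j = (if m \<in> ?A then Tp m (x j) else 0)" for m j
  have orbit: "Tp m (y i) = (\<Sum>j<n. \<Sum>k\<le>deg. F i j k *\<^sub>C s (m + p k) j)" if "m \<in> {a..b}" for m i
    unfolding y Tp_simps Tp_add
  proof (intro sum.cong refl)
    fix j k assume "k \<in> {..deg}"
    with p [of k] that have "m + p k \<in> ?A" by (auto simp: abs_le_iff)
    then show "F i j k *\<^sub>C Tp (m + p k) (x j) = F i j k *\<^sub>C s (m + p k) j"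
      by (simp add: s_def)
  qed
  have "(\<Sum>m=a..b. \<rho> powi (- 2 * m) * (\<Sum>i<n. Q (Tp m (y i)))) =
      (\<Sum>m=a..b. \<rho> powi (- 2 * m) *
        (\<Sum>i<n. Q (\<Sum>j<n. \<Sum>k\<le>deg. F i j k *\<^sub>C s (m + p k) j)))"
    by (intro sum.cong refl) (simp add: orbit)
  also have "\<dots> \<le> M * (\<Sum>m\<in>?A. \<rho> powi (- 2 * m) * (\<Sum>j<n. Q (s m j)))"
    by (rule weighted_convolution_bound [OF rho F]) (auto simp: s_def)
  also have "(\<Sum>m\<in>?A. \<rho> powi (- 2 * m) * (\<Sum>j<n. Q (s m j))) =
      (\<Sum>m\<in>?A. \<rho> powi (- 2 * m) * (\<Sum>j<n. Q (Tp m (x j))))"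
    by (intro sum.cong refl) (simp add: s_def)
  finally show ?thesis .
qed

text \<open>
  The orbit is cut at \<open>0\<close> into \<open>s1 + s2\<close>. The convolution of \<open>s1\<close> is estimated in the constant weight and that
  of \<open>s2\<close> in the weight \<open>r powi (-2 (m + 1))\<close>; both dominate \<open>weight\<close>, and they equal it on the supports
  of \<open>s1\<close> and \<open>s2\<close>. The only loss is the factor 2 from \<open>|t1 + t2|\<^sup>2 \<le> 2|t1|\<^sup>2 + 2|t2|\<^sup>2\<close>.
\<close>

lemma interior_energy_bound:
  fixes F :: "nat \<Rightarrow> nat \<Rightarrow> nat \<Rightarrow> complex" and p :: "nat \<Rightarrow> int" and x :: "nat \<Rightarrow> 'a"
  assumes F1: "\<And>z v. cmod z = 1 \<Longrightarrow>
      (\<Sum>i<n. (cmod (\<Sum>j<n. (\<Sum>k\<le>deg. F i j k * z powi p k) * v j))\<^sup>2)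
        \<le> M * (\<Sum>j<n. (cmod (v j))\<^sup>2)"
    and Fr: "\<And>z v. cmod z = r \<Longrightarrow>
      (\<Sum>i<n. (cmod (\<Sum>j<n. (\<Sum>k\<le>deg. F i j k * z powi p k) * v j))\<^sup>2)
        \<le> M * (\<Sum>j<n. (cmod (v j))\<^sup>2)"
    and p: "\<And>k. k \<le> deg \<Longrightarrow> \<bar>p k\<bar> \<le> int c"
    and y: "\<And>i. y i = (\<Sum>j<n. \<Sum>k\<le>deg. F i j k *\<^sub>C Tp (p k) (x j))"
  shows "(\<Sum>m\<in>{- int N..<int N}. weight m * (\<Sum>i<n. d.Q (Tp m (y i))))
    \<le> 2 * M * (\<Sum>m\<in>{- int (N + c)..<int (N + c)}. weight m * (\<Sum>j<n. d.Q (Tp m (x j))))"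
proof -
  let ?C = "{- int N..<int N}"
  let ?A = "{- int (N + c)..<int (N + c)}"
  let ?A1 = "{0..<int (N + c)}" and ?A2 = "{- int (N + c)..<0}"
  define s1 where "s1 m j = (if m \<in> ?A1 then Tp m (x j) else 0)" for m j
  define s2 where "s2 m j = (if m \<in> ?A2 then Tp m (x j) else 0)" for m j
  define t1 where "t1 m i = (\<Sum>j<n. \<Sum>k\<le>deg. F i j k *\<^sub>C s1 (m + p k) j)" for m i
  define t2 where "t2 m i = (\<Sum>j<n. \<Sum>k\<le>deg. F i j k *\<^sub>C s2 (m + p k) j)" for m i
  have orbit: "Tp m (y i) = t1 m i + t2 m i" if "m \<in> ?C" for m i
    unfolding y Tp_simps Tp_add t1_def t2_def sum.distrib [symmetric] scaleC_add_right [symmetric]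
  proof (intro sum.cong refl)
    fix j k assume "k \<in> {..deg}"
    with p [of k] that have "m + p k \<in> ?A" by (auto simp: abs_le_iff)
    then show "F i j k *\<^sub>C Tp (m + p k) (x j) = F i j k *\<^sub>C (s1 (m + p k) j + s2 (m + p k) j)"
      by (auto simp: s1_def s2_def)
  qed
  have 1: "(\<Sum>m\<in>?C. \<Sum>i<n. d.Q (t1 m i)) \<le> M * (\<Sum>m\<in>?A1. \<Sum>j<n. d.Q (s1 m j))"
    unfolding t1_def by (rule d.convolution_bound [OF F1]) (auto simp: s1_def)
  have 2: "(\<Sum>m\<in>?C. r powi (- 2 * m) * (\<Sum>i<n. d.Q (t2 m i)))
      \<le> M * (\<Sum>m\<in>?A2. r powi (- 2 * m) * (\<Sum>j<n. d.Q (s2 m j)))"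
    unfolding t2_def by (rule d.weighted_convolution_bound [OF r(1) Fr]) (auto simp: s2_def)
  have shift: "r powi (- 2 * (m + 1)) = inverse (r\<^sup>2) * r powi (- 2 * m)" for m
    using power_int_add [of r "- 2" "- 2 * m"] r by (simp add: algebra_simps power_int_minus)
  have "(\<Sum>m\<in>?C. weight m * (\<Sum>i<n. d.Q (Tp m (y i)))) \<le>
      (\<Sum>m\<in>?C. 2 * (\<Sum>i<n. d.Q (t1 m i)) +
        2 * inverse (r\<^sup>2) * (r powi (- 2 * m) * (\<Sum>i<n. d.Q (t2 m i))))"
  proof (rule sum_mono)
    fix m assume m: "m \<in> ?C"
    have "weight m * (\<Sum>i<n. d.Q (Tp m (y i))) \<le>
        weight m * (\<Sum>i<n. 2 * d.Q (t1 m i) + 2 * d.Q (t2 m i))"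
      by (intro mult_left_mono sum_mono weight_nonneg) (simp add: orbit [OF m] d.Q_add_le)
    also have "\<dots> = 2 * (weight m * (\<Sum>i<n. d.Q (t1 m i))) + 2 * (weight m * (\<Sum>i<n. d.Q (t2 m i)))"
      by (simp add: sum.distrib sum_distrib_left algebra_simps)
    also have "\<dots> \<le> 2 * (1 * (\<Sum>i<n. d.Q (t1 m i))) +
        2 * (r powi (- 2 * (m + 1)) * (\<Sum>i<n. d.Q (t2 m i)))"
      by (intro add_mono mult_left_mono mult_right_mono weight_le_1 weight_le_powi sum_nonneg) auto
    finally show "weight m * (\<Sum>i<n. d.Q (Tp m (y i))) \<le> 2 * (\<Sum>i<n. d.Q (t1 m i)) +
        2 * inverse (r\<^sup>2) * (r powi (- 2 * m) * (\<Sum>i<n. d.Q (t2 m i)))"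
      unfolding shift by simp
  qed
  also have "\<dots> = 2 * (\<Sum>m\<in>?C. \<Sum>i<n. d.Q (t1 m i)) +
      2 * inverse (r\<^sup>2) * (\<Sum>m\<in>?C. r powi (- 2 * m) * (\<Sum>i<n. d.Q (t2 m i)))"
    by (simp add: sum.distrib sum_distrib_left)
  also have "\<dots> \<le> 2 * (M * (\<Sum>m\<in>?A1. \<Sum>j<n. d.Q (s1 m j))) +
      2 * inverse (r\<^sup>2) * (M * (\<Sum>m\<in>?A2. r powi (- 2 * m) * (\<Sum>j<n. d.Q (s2 m j))))"
    by (intro add_mono mult_left_mono 1 2) auto
  also have "\<dots> = 2 * M * ((\<Sum>m\<in>?A1. \<Sum>j<n. d.Q (s1 m j)) +
      (\<Sum>m\<in>?A2. inverse (r\<^sup>2) * r powi (- 2 * m) * (\<Sum>j<n. d.Q (s2 m j))))"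
    by (simp add: sum_distrib_left algebra_simps)
  also have "(\<Sum>m\<in>?A1. \<Sum>j<n. d.Q (s1 m j)) =
      (\<Sum>m\<in>?A1. weight m * (\<Sum>j<n. d.Q (Tp m (x j))))"
    by (intro sum.cong refl) (simp add: s1_def weight_def)
  also have "(\<Sum>m\<in>?A2. inverse (r\<^sup>2) * r powi (- 2 * m) * (\<Sum>j<n. d.Q (s2 m j))) =
      (\<Sum>m\<in>?A2. weight m * (\<Sum>j<n. d.Q (Tp m (x j))))"
    unfolding shift [symmetric] by (intro sum.cong refl) (simp add: s2_def weight_def)
  also have "(\<Sum>m\<in>?A1. weight m * (\<Sum>j<n. d.Q (Tp m (x j)))) +
      (\<Sum>m\<in>?A2. weight m * (\<Sum>j<n. d.Q (Tp m (x j)))) =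
      (\<Sum>m\<in>?A. weight m * (\<Sum>j<n. d.Q (Tp m (x j))))"
    by (subst sum.union_disjoint [symmetric]) (auto intro!: sum.cong)
  finally show ?thesis .
qed

text \<open>
  As \<open>N\<close> tends to infinity in the energy identities of \<open>x\<close> and \<open>y\<close>, the sums over the orbit lose a factor
  \<open>2 M\<close> and the two boundary terms only a factor \<open>M\<close>. Here \<open>M\<close> bounds the square of the norm of the symbol.
\<close>

lemma laurent_estimate:
  fixes F :: "nat \<Rightarrow> nat \<Rightarrow> nat \<Rightarrow> complex" and p :: "nat \<Rightarrow> int" and x :: "nat \<Rightarrow> 'a"
  assumes M: "M \<ge> 0"
    and F1: "\<And>z v. cmod z = 1 \<Longrightarrow>
      (\<Sum>i<n. (cmod (\<Sum>j<n. (\<Sum>k\<le>deg. F i j k * z powi p k) * v j))\<^sup>2)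
        \<le> M * (\<Sum>j<n. (cmod (v j))\<^sup>2)"
    and Fr: "\<And>z v. cmod z = r \<Longrightarrow>
      (\<Sum>i<n. (cmod (\<Sum>j<n. (\<Sum>k\<le>deg. F i j k * z powi p k) * v j))\<^sup>2)
        \<le> M * (\<Sum>j<n. (cmod (v j))\<^sup>2)"
  shows "(\<Sum>i<n. (norm (\<Sum>j<n. \<Sum>k\<le>deg. F i j k *\<^sub>C Tp (p k) (x j)))\<^sup>2)
    \<le> 2 * M * (\<Sum>j<n. (norm (x j))\<^sup>2)"
proof -
  define y where "y i = (\<Sum>j<n. \<Sum>k\<le>deg. F i j k *\<^sub>C Tp (p k) (x j))" for i
  define c where "c = (\<Sum>k\<le>deg. nat \<bar>p k\<bar>)"
  have p: "\<bar>p k\<bar> \<le> int c" if "k \<le> deg" for k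
  proof -
    have "nat \<bar>p k\<bar> \<le> c" unfolding c_def by (rule member_le_sum) (use that in auto)
    then show ?thesis by linarith
  qed
  define W where "W N u = (\<Sum>m\<in>{- int N..<int N}. weight m * (\<Sum>i<n. d.Q (Tp m (u i))))"
    for N and u :: "nat \<Rightarrow> 'a"
  \<comment> \<open>the outer boundary term, decreasing in \<open>m\<close>\<close>
  define E where "E m u = (\<Sum>i<n. e.Q (Tp m (u i)))" for m and u :: "nat \<Rightarrow> 'a"
  \<comment> \<open>the inner boundary term; the orbit is run backwards, so that it decreases in \<open>m\<close> as well\<close>
  define G where "G m u = r powi (2 * m) * (\<Sum>i<n. c.Q (Tp (- m) (u i)))"
    for m and u :: "nat \<Rightarrow> 'a"
  have energy: "(1 - r\<^sup>2) * (\<Sum>i<n. (norm (u i))\<^sup>2) = W N u + E (int N) u + G (int N) u" for N u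
  proof -
    have "(1 - r\<^sup>2) * (\<Sum>i<n. (norm (u i))\<^sup>2) =
        (\<Sum>i<n. (\<Sum>m\<in>{- int N..<int N}. weight m * d.Q (Tp m (u i)))
          + e.Q (Tp (int N) (u i)) + r powi (2 * int N) * c.Q (Tp (- int N) (u i)))"
      unfolding sum_distrib_left by (intro sum.cong refl energy_identity)
    also have "\<dots> = W N u + E (int N) u + G (int N) u"
      unfolding W_def E_def G_def sum.distrib
      by (subst sum.swap) (simp add: sum_distrib_left)
    finally show ?thesis .
  qed
  have E_step: "E (m + 1) u \<le> E m u" for m u
    unfolding E_def by (intro sum_mono) (simp add: T_Tp [symmetric] e_T_le)
  have G_step: "G (m + 1) u \<le> G m u" for m u
  proof -
    have rr: "r powi (2 * (m + 1)) = r powi (2 * m) * r\<^sup>2"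
      using power_int_add [of r "2 * m" 2] r by (simp add: algebra_simps)
    have "r\<^sup>2 * c.Q (Tp (- (m + 1)) z) \<le> c.Q (Tp (- m) z)" for z
      using c_T_ge [of "Tp (- (m + 1)) z"] by (simp add: T_Tp)
    then show ?thesis
      unfolding G_def rr mult.assoc sum_distrib_left using r by (intro sum_mono mult_left_mono) auto
  qed
  have conv: "\<exists>l. (\<lambda>N. f (int N)) \<longlonglongrightarrow> l"
    if "\<And>m. f (m + 1) \<le> f m" "\<And>m. 0 \<le> f m" for f :: "int \<Rightarrow> real"
  proof -
    have "decseq (\<lambda>N. f (int N))"
    proof (rule decseq_SucI)
      show "f (int (Suc N)) \<le> f (int N)" for N
        using that(1) [of "int N"] by (simp add: add.commute)
    qed
    from decseq_convergent [OF this, of 0] that(2) show ?thesis by blast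
  qed
  have E_nonneg: "0 \<le> E m u" for m u
    by (simp add: E_def sum_nonneg)
  have G_nonneg: "0 \<le> G m u" for m u
    using r by (simp add: G_def sum_nonneg)
  obtain Ey where Ey: "(\<lambda>N. E (int N) y) \<longlonglongrightarrow> Ey"
    using conv [of "\<lambda>m. E m y", OF E_step E_nonneg] by blast
  obtain Ex where Ex: "(\<lambda>N. E (int N) x) \<longlonglongrightarrow> Ex"
    using conv [of "\<lambda>m. E m x", OF E_step E_nonneg] by blast
  obtain Gy where Gy: "(\<lambda>N. G (int N) y) \<longlonglongrightarrow> Gy"
    using conv [of "\<lambda>m. G m y", OF G_step G_nonneg] by blast
  obtain Gx where Gx: "(\<lambda>N. G (int N) x) \<longlonglongrightarrow> Gx"
    using conv [of "\<lambda>m. G m x", OF G_step G_nonneg] by blast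
  have "Ex \<ge> 0" by (rule LIMSEQ_le_const [OF Ex]) (auto simp: E_nonneg)
  have "Gx \<ge> 0" by (rule LIMSEQ_le_const [OF Gx]) (auto simp: G_nonneg)
  have E_le: "Ey \<le> M * Ex"
  proof (rule cesaro_comparison [OF E_step Ey E_step Ex M])
    fix a b
    show "(\<Sum>m=a..b. E m y) \<le> M * (\<Sum>m=a - int c..b + int c. E m x)"
      using orbit_window_bound [OF e.psd_form_axioms zero_less_one F1 p y_def, of a b]
      by (simp add: E_def)
  qed
  have G_le: "Gy \<le> M * Gx"
  proof (rule cesaro_comparison [OF G_step Gy G_step Gx M])
    fix a b
    have reflect: "(\<Sum>m=a..b. G m u) = (\<Sum>m=- b..- a. r powi (- 2 * m) * (\<Sum>i<n. c.Q (Tp m (u i))))" for a b u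
      by (rule sum.reindex_bij_witness [of _ uminus uminus]) (auto simp: G_def)
    show "(\<Sum>m=a..b. G m y) \<le> M * (\<Sum>m=a - int c..b + int c. G m x)"
      using orbit_window_bound [OF c.psd_form_axioms r(1) Fr p y_def, of "- b" "- a"]
      unfolding reflect by (simp add: algebra_simps)
  qed
  have W_le: "W N y \<le> 2 * M * W (N + c) x" for N
    unfolding W_def by (rule interior_energy_bound [OF F1 Fr p y_def])
  let ?X = "(1 - r\<^sup>2) * (\<Sum>i<n. (norm (x i))\<^sup>2)" and ?Y = "(1 - r\<^sup>2) * (\<Sum>i<n. (norm (y i))\<^sup>2)"
  have Wx: "(\<lambda>N. W N x) \<longlonglongrightarrow> ?X - Ex - Gx"
  proof -
    have "W N x = ?X - E (int N) x - G (int N) x" for N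
      using energy [of x N] by simp
    then show ?thesis using tendsto_diff [OF tendsto_diff [OF tendsto_const Ex] Gx] by simp
  qed
  have Wy: "(\<lambda>N. W N y) \<longlonglongrightarrow> ?Y - Ey - Gy"
  proof -
    have "W N y = ?Y - E (int N) y - G (int N) y" for N
      using energy [of y N] by simp
    then show ?thesis using tendsto_diff [OF tendsto_diff [OF tendsto_const Ey] Gy] by simp
  qed
  have "?Y - Ey - Gy \<le> 2 * M * (?X - Ex - Gx)"
    by (rule LIMSEQ_le [OF Wy tendsto_mult_left [OF LIMSEQ_ignore_initial_segment [OF Wx, of c]]])
      (use W_le in auto)
  also have "\<dots> = 2 * M * ?X - 2 * (M * Ex) - 2 * (M * Gx)" by (simp add: algebra_simps)
  finally have "?Y \<le> 2 * M * ?X"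
    using E_le G_le mult_nonneg_nonneg [OF M \<open>Ex \<ge> 0\<close>] mult_nonneg_nonneg [OF M \<open>Gx \<ge> 0\<close>]
    by linarith
  then have "(1 - r\<^sup>2) * (\<Sum>i<n. (norm (y i))\<^sup>2) \<le> (1 - r\<^sup>2) * (2 * M * (\<Sum>i<n. (norm (x i))\<^sup>2))"
    by (simp only: mult_ac)
  moreover have "0 < 1 - r\<^sup>2"
    using r by (simp add: power_less_one_iff)
  ultimately show ?thesis
    unfolding y_def by (simp only: mult_le_cancel_left_pos)
qed

end

section \<open>Polynomials in an operator and Neumann series\<close>

lemma poly_op_upto:
  assumes "degree p \<le> N"
  shows "poly_op p T x = (\<Sum>k\<le>N. coeff p k *\<^sub>C (T ^^ k) x)"
  unfolding poly_op_def
  by (rule sum.mono_neutral_left) (use assms in \<open>auto simp: coeff_eq_0\<close>)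

lemma poly_op_0 [simp]: "poly_op 0 T x = 0"
  by (simp add: poly_op_def)

lemma poly_op_add: "poly_op (p + q) T x = poly_op p T x + poly_op q T x"
proof -
  let ?N = "max (degree p) (degree q)"
  have "degree (p + q) \<le> ?N" by (rule degree_add_le) auto
  then show ?thesis
    by (simp add: poly_op_upto [of _ ?N] scaleC_add_left sum.distrib)
qed

lemma poly_op_smult: "poly_op (smult a p) T x = a *\<^sub>C poly_op p T x"
  by (simp add: poly_op_upto [of "smult a p" "degree p"] degree_smult_le)
    (simp add: poly_op_def scaleC_sum_right scaleC_scaleC)

lemma poly_op_pCons:
  assumes "bounded_clinear T"
  shows "poly_op (pCons a p) T x = a *\<^sub>C x + T (poly_op p T x)"
proof -
  have "poly_op (pCons a p) T x = (\<Sum>k\<le>Suc (degree p). coeff (pCons a p) k *\<^sub>C (T ^^ k) x)"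
    by (rule poly_op_upto) (simp add: degree_pCons_le)
  also have "\<dots> = a *\<^sub>C x + (\<Sum>k\<le>degree p. coeff p k *\<^sub>C T ((T ^^ k) x))"
    by (subst sum.atMost_Suc_shift) simp
  finally show ?thesis
    by (simp add: poly_op_def bounded_clinearD [OF assms])
qed

lemma poly_op_clinear:
  assumes "bounded_clinear T" shows "bounded_clinear (poly_op p T)"
  unfolding poly_op_def
  by (intro bounded_clinear_sum bounded_clinear_compose [OF bounded_clinear_scaleC]
      bounded_clinear_funpow assms)

lemma poly_op_mult:
  assumes "bounded_clinear T"
  shows "poly_op (p * q) T x = poly_op p T (poly_op q T x)"
  by (induction p)
    (simp_all add: poly_op_add poly_op_smult poly_op_pCons [OF assms])

text \<open>
  Besides the inverse of \<open>1 - C\<close> this records the rate of convergence, which is needed to carry over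
  approximations by Laurent polynomials from the partial sums to the inverse.
\<close>

lemma neumann_series:
  fixes C :: "'a::chilbert_space \<Rightarrow> 'a"
  assumes C: "bounded_clinear C" and bound: "\<And>x. norm (C x) \<le> \<rho> * norm x"
    and rho: "0 \<le> \<rho>" "\<rho> < 1"
  shows "\<exists>G. bounded_clinear G \<and> (\<forall>x. G (x - C x) = x) \<and> (\<forall>x. G x - C (G x) = x) \<and>
    (\<forall>N x. norm (G x - (\<Sum>k<N. (C ^^ k) x)) \<le> \<rho> ^ N / (1 - \<rho>) * norm x)"
proof -
  note Cs = bounded_clinearD [OF C] and Cn = bounded_clinearD [OF bounded_clinear_funpow [OF C]]
  have pow: "norm ((C ^^ k) x) \<le> \<rho> ^ k * norm x" for k x
  proof (induction k)
    case (Suc k)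
    have "norm (C ((C ^^ k) x)) \<le> \<rho> * norm ((C ^^ k) x)" by (rule bound)
    also have "\<dots> \<le> \<rho> * (\<rho> ^ k * norm x)" by (intro mult_left_mono Suc rho)
    finally show ?case by (simp add: mult.assoc)
  qed simp
  have geo: "summable (\<lambda>k. \<rho> ^ (k + N) * norm x)" for N and x :: 'a
    using rho by (intro summable_mult2 summable_ignore_initial_segment summable_geometric) simp
  have geo_sum: "(\<Sum>k. \<rho> ^ (k + N) * norm x) = \<rho> ^ N / (1 - \<rho>) * norm x" for N and x :: 'a
    using rho by (simp add: power_add suminf_mult2 [symmetric] suminf_geometric summable_geometric
        summable_mult2)
  have sm: "summable (\<lambda>k. (C ^^ k) x)" for x
    by (rule summable_comparison_test' [OF geo [of 0 x]]) (use pow in simp)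
  define G where "G x = (\<Sum>k. (C ^^ k) x)" for x
  have tail: "norm (G x - (\<Sum>k<N. (C ^^ k) x)) \<le> \<rho> ^ N / (1 - \<rho>) * norm x" for N x
  proof -
    have "G x - (\<Sum>k<N. (C ^^ k) x) = (\<Sum>k. (C ^^ (k + N)) x)"
      unfolding G_def by (rule suminf_minus_initial_segment [OF sm, symmetric])
    also have "norm \<dots> \<le> (\<Sum>k. \<rho> ^ (k + N) * norm x)"
    proof (rule norm_suminf_le [OF _ geo])
      show "norm ((C ^^ (k + N)) x) \<le> \<rho> ^ (k + N) * norm x" for k by (rule pow)
    qed
    finally show ?thesis by (simp only: geo_sum)
  qed
  have G_add: "G (x + y) = G x + G y" for x y
    unfolding G_def Cn by (rule suminf_add [OF sm sm, symmetric])
  have G_scale: "G (a *\<^sub>C x) = a *\<^sub>C G x" for a x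
    unfolding G_def Cn
    by (rule bounded_linear.suminf [OF bounded_clinearD(1) [OF bounded_clinear_scaleC] sm, symmetric])
  have "bounded_linear G"
  proof (rule bounded_linear_intro [where K = "1 / (1 - \<rho>)"])
    show "G (t *\<^sub>R x) = t *\<^sub>R G x" for t x by (simp only: scaleC_of_real [symmetric] G_scale)
    show "norm (G x) \<le> norm x * (1 / (1 - \<rho>))" for x
      using tail [of x 0] by simp
  qed (rule G_add)
  with G_scale have G: "bounded_clinear G" by (simp add: bounded_clinear_def)
  have head: "G x = x + (\<Sum>k. (C ^^ Suc k) x)" for x
    using suminf_split_head [OF sm [of x]] by (simp add: G_def algebra_simps)
  have CG: "C (G x) = (\<Sum>k. C ((C ^^ k) x))" for x
    unfolding G_def by (rule bounded_linear.suminf [OF Cs(1) sm])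
  have "G x - C (G x) = x" for x
    unfolding CG using head [of x] by simp
  moreover have "G (C x) = (\<Sum>k. (C ^^ Suc k) x)" for x
    unfolding G_def by (simp add: funpow_swap1)
  then have "G (x - C x) = x" for x
    using head [of x] by (simp add: bounded_clinearD [OF G])
  ultimately show ?thesis using G tail by blast
qed


section \<open>Approximation of rational functions by Laurent polynomials\<close>

context annulus_operator
begin

abbreviation X :: "complex set" where "X \<equiv> closed_annulus r"

lemma X_nonzero: "z \<in> X \<Longrightarrow> z \<noteq> 0"
  using r by (auto simp: closed_annulus_def)

text \<open>
  The value at \<open>T\<close> of the Laurent polynomial \<open>poly q z / z ^ K\<close>.
\<close>

definition laurent_op :: "nat \<Rightarrow> complex poly \<Rightarrow> 'a \<Rightarrow> 'a"
  where "laurent_op K q x = Tp (- int K) (poly_op q T x)"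

lemma funpow_Tp: "(T ^^ k) x = Tp (int k) x"
  by (simp add: Tp_def)

lemma poly_op_Tp: "poly_op q T (Tp m x) = Tp m (poly_op q T x)"
  by (simp add: poly_op_def funpow_Tp Tp_simps Tp_add add.commute)

lemma poly_op_monom: "poly_op (monom 1 k) T x = Tp (int k) x"
proof (induction k)
  case 0
  show ?case by (simp add: monom_0 poly_op_pCons [OF T] bounded_clinearD(4) [OF T])
next
  case (Suc k)
  then show ?case by (simp add: monom_Suc poly_op_pCons [OF T] T_Tp add.commute)
qed

lemma laurent_op_lift: "laurent_op (K + L) (q * monom 1 L) x = laurent_op K q x"
  by (simp add: laurent_op_def poly_op_mult [OF T] poly_op_monom poly_op_Tp Tp_add)

lemma laurent_op_add:
  "laurent_op K p x + laurent_op L q x = laurent_op (K + L) (p * monom 1 L + q * monom 1 K) x"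
proof -
  have "laurent_op (K + L) (p * monom 1 L + q * monom 1 K) x =
      laurent_op (K + L) (p * monom 1 L) x + laurent_op (L + K) (q * monom 1 K) x"
    by (simp add: laurent_op_def poly_op_add Tp_simps add.commute)
  then show ?thesis by (simp only: laurent_op_lift)
qed

lemma laurent_op_mult: "laurent_op K p (laurent_op L q x) = laurent_op (K + L) (p * q) x"
  by (simp add: laurent_op_def poly_op_Tp Tp_add poly_op_mult [OF T])

text \<open>
  The pair \<open>(g, G)\<close> lies in the closure of the pairs of a Laurent polynomial on the annulus and its value at \<open>T\<close>,
  with respect to the supremum norm and the operator norm simultaneously. Boundedness of \<open>g\<close> and
  \<open>G\<close> is included because products of approximations need it.
\<close>

definition approximable :: "(complex \<Rightarrow> complex) \<Rightarrow> ('a \<Rightarrow> 'a) \<Rightarrow> bool"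
  where "approximable g G \<longleftrightarrow> bounded_clinear G \<and> (\<exists>C. \<forall>z\<in>X. cmod (g z) \<le> C) \<and>
    (\<forall>\<epsilon>>0. \<exists>K q. (\<forall>z\<in>X. cmod (g z - poly q z / z ^ K) \<le> \<epsilon>) \<and>
      (\<forall>x. norm (G x - laurent_op K q x) \<le> \<epsilon> * norm x))"

lemma approximable_cong:
  assumes "approximable g G" and "\<And>z. z \<in> X \<Longrightarrow> g z = g' z" and "\<And>x. G x = G' x"
  shows "approximable g' G'"
proof -
  have "G = G'" using assms(3) by blast
  with assms(1) show ?thesis unfolding approximable_def by (simp add: assms(2) cong: ball_cong)
qed

lemma approximable_laurent:
  assumes "\<And>z. z \<in> X \<Longrightarrow> g z = poly q z / z ^ K" and "\<And>x. G x = laurent_op K q x"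
    and "\<And>z. z \<in> X \<Longrightarrow> cmod (g z) \<le> C"
  shows "approximable g G"
proof -
  have "G = (\<lambda>x. Tp (- int K) (poly_op q T x))"
    using assms(2) by (auto simp: laurent_op_def)
  then have "bounded_clinear G"
    using bounded_clinear_compose [OF Tp_clinear poly_op_clinear [OF T]] by simp
  then show ?thesis unfolding approximable_def
    using assms by (fastforce intro!: exI [of _ K] exI [of _ q])
qed

lemma approximable_poly: "approximable (poly q) (poly_op q T)"
proof (rule approximable_laurent [where K = 0])
  fix z assume z: "z \<in> X"
  have "cmod (poly q z) \<le> (\<Sum>k\<le>degree q. cmod (coeff q k * z ^ k))"
    unfolding poly_altdef by (rule norm_sum)
  also have "\<dots> \<le> (\<Sum>k\<le>degree q. cmod (coeff q k) * 1)"
    using z by (intro sum_mono)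
      (auto simp: norm_mult norm_power closed_annulus_def intro!: mult_left_le power_le_one)
  finally show "cmod (poly q z) \<le> (\<Sum>k\<le>degree q. cmod (coeff q k) * 1)" .
qed (simp_all add: laurent_op_def)

lemma approximable_inverse: "approximable (\<lambda>z. 1 / z) S"
proof (rule approximable_laurent [where K = 1 and q = 1 and C = "1 / r"])
  show "S x = laurent_op 1 1 x" for x
    using S_Tp [of 0 x] by (simp add: laurent_op_def one_pCons poly_op_pCons [OF T] bounded_clinearD(4) [OF T])
  show "cmod (1 / z) \<le> 1 / r" if "z \<in> X" for z
    using that r by (simp add: closed_annulus_def norm_divide frac_le)
qed simp

lemma approximable_add:
  assumes "approximable g1 G1" "approximable g2 G2"
  shows "approximable (\<lambda>z. g1 z + g2 z) (\<lambda>x. G1 x + G2 x)"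
  unfolding approximable_def
proof (intro conjI allI impI)
  show "bounded_clinear (\<lambda>x. G1 x + G2 x)"
    using assms by (auto simp: approximable_def intro: bounded_clinear_add)
  obtain C1 C2 where "\<And>z. z \<in> X \<Longrightarrow> cmod (g1 z) \<le> C1" "\<And>z. z \<in> X \<Longrightarrow> cmod (g2 z) \<le> C2"
    using assms unfolding approximable_def by metis
  then show "\<exists>C. \<forall>z\<in>X. cmod (g1 z + g2 z) \<le> C"
    by (intro exI [of _ "C1 + C2"] ballI norm_triangle_mono)
  fix \<epsilon> :: real assume "\<epsilon> > 0"
  then have half: "\<epsilon> / 2 > 0" by simp
  obtain K1 q1 where 1: "\<And>z. z \<in> X \<Longrightarrow> cmod (g1 z - poly q1 z / z ^ K1) \<le> \<epsilon> / 2"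
    "\<And>x. norm (G1 x - laurent_op K1 q1 x) \<le> \<epsilon> / 2 * norm x"
    using assms(1) half unfolding approximable_def by metis
  obtain K2 q2 where 2: "\<And>z. z \<in> X \<Longrightarrow> cmod (g2 z - poly q2 z / z ^ K2) \<le> \<epsilon> / 2"
    "\<And>x. norm (G2 x - laurent_op K2 q2 x) \<le> \<epsilon> / 2 * norm x"
    using assms(2) half unfolding approximable_def by metis
  let ?K = "K1 + K2" and ?q = "q1 * monom 1 K2 + q2 * monom 1 K1"
  have "cmod (g1 z + g2 z - poly ?q z / z ^ ?K) \<le> \<epsilon>" if z: "z \<in> X" for z
  proof -
    have "g1 z + g2 z - poly ?q z / z ^ ?K =
        (g1 z - poly q1 z / z ^ K1) + (g2 z - poly q2 z / z ^ K2)"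
      using X_nonzero [OF z] by (simp add: poly_monom power_add field_simps)
    then show ?thesis
      using norm_triangle_mono [OF 1(1) [OF z] 2(1) [OF z]] by (simp only: field_sum_of_halves)
  qed
  moreover have "norm (G1 x + G2 x - laurent_op ?K ?q x) \<le> \<epsilon> * norm x" for x
  proof -
    have "G1 x + G2 x - laurent_op ?K ?q x =
        (G1 x - laurent_op K1 q1 x) + (G2 x - laurent_op K2 q2 x)"
      unfolding laurent_op_add [symmetric] by simp
    then show ?thesis
      using norm_triangle_mono [OF 1(2) [of x] 2(2) [of x]]
      by (simp only: distrib_right [symmetric] field_sum_of_halves)
  qed
  ultimately show "\<exists>K q. (\<forall>z\<in>X. cmod (g1 z + g2 z - poly q z / z ^ K) \<le> \<epsilon>) \<and>
      (\<forall>x. norm (G1 x + G2 x - laurent_op K q x) \<le> \<epsilon> * norm x)"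
    by blast
qed

lemma approximable_mult:
  assumes "approximable g1 G1" "approximable g2 G2"
  shows "approximable (\<lambda>z. g1 z * g2 z) (\<lambda>x. G1 (G2 x))"
  unfolding approximable_def
proof (intro conjI allI impI)
  have lin: "bounded_clinear G1" "bounded_clinear G2" using assms by (auto simp: approximable_def)
  show "bounded_clinear (\<lambda>x. G1 (G2 x))" by (rule bounded_clinear_compose [OF lin])
  obtain C1 C2 where C12: "\<And>z. z \<in> X \<Longrightarrow> cmod (g1 z) \<le> C1" "\<And>z. z \<in> X \<Longrightarrow> cmod (g2 z) \<le> C2"
    using assms unfolding approximable_def by metis
  obtain B1 B2 where B12: "\<And>x. norm (G1 x) \<le> norm x * B1" "\<And>x. norm (G2 x) \<le> norm x * B2"
    using lin bounded_linear.bounded unfolding bounded_clinear_def by metis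
  define D where "D = \<bar>C1\<bar> + \<bar>C2\<bar> + \<bar>B1\<bar> + \<bar>B2\<bar>"
  have D: "D \<ge> 0" by (simp add: D_def)
  have C: "cmod (g1 z) \<le> D" "cmod (g2 z) \<le> D" if "z \<in> X" for z
    using C12 [OF that] by (auto simp: D_def)
  have B: "norm (G1 x) \<le> D * norm x" "norm (G2 x) \<le> D * norm x" for x
  proof -
    have "norm x * B1 \<le> norm x * D" "norm x * B2 \<le> norm x * D"
      by (auto intro!: mult_left_mono simp: D_def)
    then show "norm (G1 x) \<le> D * norm x" "norm (G2 x) \<le> D * norm x"
      using B12 [of x] by (auto simp: mult.commute)
  qed
  show "\<exists>C. \<forall>z\<in>X. cmod (g1 z * g2 z) \<le> C"
    using C D by (intro exI [of _ "D * D"]) (auto simp: norm_mult intro!: mult_mono)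
  fix \<epsilon> :: real assume \<epsilon>: "\<epsilon> > 0"
  define \<delta> where "\<delta> = min 1 (\<epsilon> / (2 * D + 1))"
  have \<delta>: "\<delta> > 0" "\<delta> \<le> 1" using \<epsilon> D by (auto simp: \<delta>_def)
  have "\<delta> * (2 * D + 1) \<le> \<epsilon> / (2 * D + 1) * (2 * D + 1)"
    using D by (intro mult_right_mono) (auto simp: \<delta>_def)
  then have small: "\<delta> * (2 * D + 1) \<le> \<epsilon>" using D by simp
  \<comment> \<open>error of the product of two approximations with error \<delta> in a normed algebra\<close>
  have total: "D * (\<delta> * t) + \<delta> * ((D + \<delta>) * t) \<le> \<epsilon> * t" if t: "t \<ge> 0" for t
  proof -
    have "D * \<delta> + \<delta> * (D + \<delta>) \<le> \<delta> * (2 * D + 1)"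
      using \<delta> by (simp add: algebra_simps mult_left_le)
    then have "D * \<delta> + \<delta> * (D + \<delta>) \<le> \<epsilon>" using small by linarith
    from mult_right_mono [OF this t] show ?thesis by (simp add: algebra_simps)
  qed
  obtain K1 q1 where 1: "\<And>z. z \<in> X \<Longrightarrow> cmod (g1 z - poly q1 z / z ^ K1) \<le> \<delta>"
    "\<And>x. norm (G1 x - laurent_op K1 q1 x) \<le> \<delta> * norm x"
    using assms(1) \<delta>(1) unfolding approximable_def by metis
  obtain K2 q2 where 2: "\<And>z. z \<in> X \<Longrightarrow> cmod (g2 z - poly q2 z / z ^ K2) \<le> \<delta>"
    "\<And>x. norm (G2 x - laurent_op K2 q2 x) \<le> \<delta> * norm x"
    using assms(2) \<delta>(1) unfolding approximable_def by metis
  have "cmod (g1 z * g2 z - poly (q1 * q2) z / z ^ (K1 + K2)) \<le> \<epsilon>" if z: "z \<in> X" for z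
  proof -
    let ?l1 = "poly q1 z / z ^ K1" and ?l2 = "poly q2 z / z ^ K2"
    have l2: "cmod ?l2 \<le> D + \<delta>"
      using norm_triangle_ineq2 [of ?l2 "g2 z"] 2(1) [OF z] C(2) [OF z]
      by (simp add: norm_minus_commute)
    have "g1 z * g2 z - poly (q1 * q2) z / z ^ (K1 + K2) = g1 z * (g2 z - ?l2) + (g1 z - ?l1) * ?l2"
      by (simp add: power_add algebra_simps)
    also have "cmod \<dots> \<le> D * \<delta> + \<delta> * (D + \<delta>)"
      unfolding norm_mult
      by (rule norm_triangle_mono) (auto simp only: norm_mult intro!: mult_mono C 1 2 z l2 D less_imp_le [OF \<delta>(1)] norm_ge_zero)
    finally show ?thesis using total [of 1] by simp
  qed
  moreover have "norm (G1 (G2 x) - laurent_op (K1 + K2) (q1 * q2) x) \<le> \<epsilon> * norm x" for x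
  proof -
    let ?l = "laurent_op K2 q2 x"
    have l: "norm ?l \<le> (D + \<delta>) * norm x"
      using norm_triangle_ineq2 [of ?l "G2 x"] 2(2) [of x] B(2) [of x]
      by (simp add: norm_minus_commute algebra_simps)
    have "G1 (G2 x) - laurent_op (K1 + K2) (q1 * q2) x =
        G1 (G2 x - ?l) + (G1 ?l - laurent_op K1 q1 ?l)"
      by (simp add: laurent_op_mult bounded_clinearD(3) [OF lin(1)])
    also have "norm \<dots> \<le> D * norm (G2 x - ?l) + \<delta> * norm ?l"
      by (rule norm_triangle_mono [OF B(1) 1(2)])
    also have "\<dots> \<le> D * (\<delta> * norm x) + \<delta> * ((D + \<delta>) * norm x)"
      by (intro add_mono mult_left_mono 2 l D less_imp_le [OF \<delta>(1)])
    also have "\<dots> \<le> \<epsilon> * norm x" by (rule total) simp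
    finally show ?thesis .
  qed
  ultimately show "\<exists>K q. (\<forall>z\<in>X. cmod (g1 z * g2 z - poly q z / z ^ K) \<le> \<epsilon>) \<and>
      (\<forall>x. norm (G1 (G2 x) - laurent_op K q x) \<le> \<epsilon> * norm x)"
    by blast
qed

lemma approximable_limit:
  assumes G: "bounded_clinear G"
    and approx: "\<And>\<epsilon>. \<epsilon> > 0 \<Longrightarrow> \<exists>h H. approximable h H \<and> (\<forall>z\<in>X. cmod (g z - h z) \<le> \<epsilon>) \<and>
      (\<forall>x. norm (G x - H x) \<le> \<epsilon> * norm x)"
  shows "approximable g G"
  unfolding approximable_def
proof (intro conjI allI impI G)
  obtain h H where h: "approximable h H" "\<And>z. z \<in> X \<Longrightarrow> cmod (g z - h z) \<le> 1"
    using approx [of 1] by auto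
  obtain C where "\<And>z. z \<in> X \<Longrightarrow> cmod (h z) \<le> C" using h(1) unfolding approximable_def by metis
  with h(2) show "\<exists>C. \<forall>z\<in>X. cmod (g z) \<le> C"
    by (intro exI [of _ "C + 1"] ballI) (smt (verit) norm_triangle_sub)
  fix \<epsilon> :: real assume "\<epsilon> > 0"
  then have half: "\<epsilon> / 2 > 0" by simp
  obtain h H where h: "approximable h H" "\<And>z. z \<in> X \<Longrightarrow> cmod (g z - h z) \<le> \<epsilon> / 2"
    "\<And>x. norm (G x - H x) \<le> \<epsilon> / 2 * norm x"
    using approx [OF half] by blast
  obtain K q where q: "\<And>z. z \<in> X \<Longrightarrow> cmod (h z - poly q z / z ^ K) \<le> \<epsilon> / 2"
    "\<And>x. norm (H x - laurent_op K q x) \<le> \<epsilon> / 2 * norm x"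
    using h(1) half unfolding approximable_def by metis
  have "cmod (g z - poly q z / z ^ K) \<le> \<epsilon>" if "z \<in> X" for z
    using norm_triangle_mono [OF h(2) [OF that] q(1) [OF that]] by simp
  moreover have "norm (G x - laurent_op K q x) \<le> \<epsilon> * norm x" for x
    using norm_triangle_mono [OF h(3) [of x] q(2) [of x]] by simp
  ultimately show "\<exists>K q. (\<forall>z\<in>X. cmod (g z - poly q z / z ^ K) \<le> \<epsilon>) \<and>
      (\<forall>x. norm (G x - laurent_op K q x) \<le> \<epsilon> * norm x)"
    by blast
qed

lemma approximable_partial_sum:
  assumes "approximable h C"
  shows "approximable (\<lambda>z. \<Sum>k<N. h z ^ k) (\<lambda>x. \<Sum>k<N. (C ^^ k) x)"
proof -
  have power: "approximable (\<lambda>z. h z ^ k) (C ^^ k)" for k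
  proof (induction k)
    case 0
    show ?case
      by (rule approximable_cong [OF approximable_poly [of 1]])
        (simp_all add: one_pCons poly_op_pCons [OF T] bounded_clinearD(4) [OF T])
  next
    case (Suc k)
    show ?case
      by (rule approximable_cong [OF approximable_mult [OF assms Suc]]) simp_all
  qed
  show ?thesis
  proof (induction N)
    case 0
    show ?case by (rule approximable_cong [OF approximable_poly [of 0]]) simp_all
  next
    case (Suc N)
    show ?case
      by (rule approximable_cong [OF approximable_add [OF Suc power [of N]]]) simp_all
  qed
qed

text \<open>
  Sums, products and limits stay inside the algebra of approximable pairs, hence so does the geometric series.
\<close>

lemma approximable_neumann:
  assumes C: "approximable h C" and rho: "0 \<le> \<rho>" "\<rho> < 1"
    and h: "\<And>z. z \<in> X \<Longrightarrow> cmod (h z) \<le> \<rho>" and bound: "\<And>x. norm (C x) \<le> \<rho> * norm x"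
  shows "\<exists>G. approximable (\<lambda>z. 1 / (1 - h z)) G \<and> (\<forall>x. G (x - C x) = x) \<and> (\<forall>x. G x - C (G x) = x)"
proof -
  have "bounded_clinear C" using C by (simp add: approximable_def)
  from neumann_series [OF this bound rho] obtain G where G: "bounded_clinear G"
    "\<And>x. G (x - C x) = x" "\<And>x. G x - C (G x) = x"
    "\<And>N x. norm (G x - (\<Sum>k<N. (C ^^ k) x)) \<le> \<rho> ^ N / (1 - \<rho>) * norm x"
    by blast
  have "approximable (\<lambda>z. 1 / (1 - h z)) G"
  proof (rule approximable_limit [OF G(1)])
    fix \<epsilon> :: real assume \<epsilon>: "\<epsilon> > 0"
    then obtain N where "\<rho> ^ N < \<epsilon> * (1 - \<rho>)"
      using real_arch_pow_inv [of "\<epsilon> * (1 - \<rho>)" \<rho>] rho by auto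
    then have N: "\<rho> ^ N / (1 - \<rho>) \<le> \<epsilon>" using rho by (simp add: pos_divide_le_eq)
    have "cmod (1 / (1 - h z) - (\<Sum>k<N. h z ^ k)) \<le> \<epsilon>" if z: "z \<in> X" for z
    proof -
      have h1: "h z \<noteq> 1" using h [OF z] rho by auto
      then have "1 / (1 - h z) - (\<Sum>k<N. h z ^ k) = h z ^ N / (1 - h z)"
        by (simp add: sum_gp_strict diff_divide_distrib)
      moreover have "1 - \<rho> \<le> cmod (1 - h z)"
        using norm_triangle_ineq2 [of 1 "h z"] h [OF z] by simp
      then have "cmod (h z) ^ N / cmod (1 - h z) \<le> \<rho> ^ N / (1 - \<rho>)"
        using h [OF z] rho by (intro frac_le power_mono) auto
      ultimately show ?thesis using N by (simp add: norm_divide norm_power)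
    qed
    moreover have "norm (G x - (\<Sum>k<N. (C ^^ k) x)) \<le> \<epsilon> * norm x" for x
      using G(4) [of x N] mult_right_mono [OF N, of "norm x"] by simp
    ultimately show "\<exists>h' H. approximable h' H \<and> (\<forall>z\<in>X. cmod (1 / (1 - h z) - h' z) \<le> \<epsilon>) \<and>
      (\<forall>x. norm (G x - H x) \<le> \<epsilon> * norm x)"
      using approximable_partial_sum [OF C, of N] by blast
  qed
  with G show ?thesis by blast
qed

text \<open>
  If \<open>a\<close> lies outside the unit disc, then \<open>z - a = - a (1 - z/a)\<close>, where \<open>|z/a| \<le> 1/|a| < 1\<close> on the annulus and \<open>T\<close> is a
  contraction. If it lies in the hole, then \<open>z - a = z (1 - a/z)\<close>, where \<open>|a/z| \<le> |a|/r < 1\<close> and the inverse of \<open>T\<close> has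
  norm at most \<open>1/r\<close>.
\<close>

lemma approximable_resolvent:
  assumes a: "a \<notin> X"
  shows "\<exists>R. approximable (\<lambda>z. 1 / (z - a)) R \<and>
    (\<forall>x. R (T x - a *\<^sub>C x) = x) \<and> (\<forall>x. T (R x) - a *\<^sub>C R x = x)"
proof (cases "cmod a > 1")
  case True
  then have a0: "a \<noteq> 0" by auto
  have ha: "approximable (\<lambda>z. z / a) (\<lambda>x. (1 / a) *\<^sub>C T x)"
    by (rule approximable_cong [OF approximable_poly [of "[:0, 1 / a:]"]])
      (simp_all add: poly_op_pCons [OF T] bounded_clinearD [OF T])
  have "cmod (z / a) \<le> 1 / cmod a" if "z \<in> X" for z
    using that True by (simp add: closed_annulus_def norm_divide divide_right_mono)
  moreover have "norm ((1 / a) *\<^sub>C T x) \<le> 1 / cmod a * norm x" for x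
    using norm_T_le [of x] by (simp add: norm_scaleC norm_divide divide_right_mono)
  moreover have "0 \<le> 1 / cmod a" "1 / cmod a < 1"
    using True a0 by (auto simp: divide_less_eq_1_pos)
  ultimately obtain G where G: "approximable (\<lambda>z. 1 / (1 - z / a)) G"
    "\<And>x. G (x - (1 / a) *\<^sub>C T x) = x" "\<And>x. G x - (1 / a) *\<^sub>C T (G x) = x"
    using approximable_neumann [OF ha, of "1 / cmod a"] by blast
  define R where "R x = (- 1 / a) *\<^sub>C G x" for x
  have lin: "bounded_clinear G" using G(1) by (simp add: approximable_def)
  have "approximable (\<lambda>z. 1 / (z - a)) R"
  proof (rule approximable_cong [OF approximable_mult [OF approximable_poly [of "[:- 1 / a:]"] G(1)]])
    show "poly [:- 1 / a:] z * (1 / (1 - z / a)) = 1 / (z - a)" if "z \<in> X" for z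
    proof -
      have "z \<noteq> a" using that a by auto
      then show ?thesis using a0 by (simp add: field_simps)
    qed
    show "poly_op [:- 1 / a:] T (G x) = R x" for x
      by (simp add: poly_op_pCons [OF T] bounded_clinearD(4) [OF T] R_def)
  qed
  moreover have "R (T x - a *\<^sub>C x) = x" for x
  proof -
    have "(- 1 / a) *\<^sub>C (T x - a *\<^sub>C x) = x - (1 / a) *\<^sub>C T x"
      using a0 by (simp add: scaleC_diff_right scaleC_scaleC scaleC_minus_left)
    then show ?thesis unfolding R_def using G(2) [of x] by (simp only: bounded_clinearD(6) [OF lin, symmetric])
  qed
  moreover have "T (R x) - a *\<^sub>C R x = x" for x
    using G(3) [of x] a0
    by (simp add: R_def bounded_clinearD [OF T] scaleC_scaleC scaleC_minus_left scaleC_minus_right)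
  ultimately show ?thesis by blast
next
  case False
  then have ar: "cmod a < r" using a by (auto simp: closed_annulus_def)
  have ha: "approximable (\<lambda>z. a * (1 / z)) (\<lambda>x. a *\<^sub>C S x)"
    by (rule approximable_cong [OF approximable_mult [OF approximable_poly [of "[:a:]"] approximable_inverse]])
      (simp_all add: poly_op_pCons [OF T] bounded_clinearD(4) [OF T])
  have "cmod (a * (1 / z)) \<le> cmod a / r" if "z \<in> X" for z
    using that r by (simp add: closed_annulus_def norm_divide norm_mult frac_le)
  moreover have "norm (a *\<^sub>C S x) \<le> cmod a / r * norm x" for x
    using mult_left_mono [OF norm_S_le [of x], of "cmod a"] by (simp add: norm_scaleC)
  moreover have "0 \<le> cmod a / r" "cmod a / r < 1" using ar r by auto
  ultimately obtain G where G: "approximable (\<lambda>z. 1 / (1 - a * (1 / z))) G"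
    "\<And>x. G (x - a *\<^sub>C S x) = x" "\<And>x. G x - a *\<^sub>C S (G x) = x"
    using approximable_neumann [OF ha, of "cmod a / r"] by blast
  define R where "R x = G (S x)" for x
  have "approximable (\<lambda>z. 1 / (z - a)) R"
  proof (rule approximable_cong [OF approximable_mult [OF G(1) approximable_inverse]])
    show "1 / (1 - a * (1 / z)) * (1 / z) = 1 / (z - a)" if "z \<in> X" for z
      using X_nonzero [OF that] by (simp add: field_simps)
  qed (simp add: R_def)
  moreover have "R (T x - a *\<^sub>C x) = x" for x
    using G(2) [of x] by (simp add: R_def bounded_clinearD [OF S])
  moreover have "T (R x) - a *\<^sub>C R x = x" for x
    using arg_cong [OF G(3) [of "S x"], of T] by (simp add: R_def bounded_clinearD [OF T])
  ultimately show ?thesis by blast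
qed

text \<open>
  Induction over the linear factors, whose roots all lie outside the annulus.
\<close>

lemma approximable_inverse_poly:
  assumes "q \<noteq> 0" and "\<And>z. z \<in> X \<Longrightarrow> poly q z \<noteq> 0"
  shows "\<exists>G. approximable (\<lambda>z. 1 / poly q z) G \<and>
    (\<forall>x. G (poly_op q T x) = x) \<and> (\<forall>x. poly_op q T (G x) = x)"
  using assms
proof (induction "degree q" arbitrary: q)
  case 0
  then obtain c where q: "q = [:c:]" by (metis degree_eq_zeroE)
  with 0 have c: "c \<noteq> 0" by simp
  have "approximable (\<lambda>z. 1 / poly q z) (\<lambda>x. (1 / c) *\<^sub>C x)"
    by (rule approximable_cong [OF approximable_poly [of "[:1 / c:]"]])
      (simp_all add: q poly_op_pCons [OF T] bounded_clinearD(4) [OF T])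
  then show ?case
    using c by (intro exI [of _ "\<lambda>x. (1 / c) *\<^sub>C x"])
      (simp add: q poly_op_pCons [OF T] bounded_clinearD(4) [OF T] scaleC_scaleC)
next
  case (Suc m)
  have "\<not> constant (poly q)" using Suc.hyps(2) by (simp add: constant_degree)
  then obtain a where "poly q a = 0" using fundamental_theorem_of_algebra by blast
  moreover from this have a: "a \<notin> X" using Suc.prems by blast
  ultimately obtain q' where q': "q = [:- a, 1:] * q'" by (auto simp: poly_eq_0_iff_dvd elim: dvdE)
  have nz: "q' \<noteq> 0" using Suc.prems q' by auto
  then have "degree q = Suc (degree q')" unfolding q' by (subst degree_mult_eq) auto
  then have "m = degree q'" using Suc.hyps(2) by simp
  moreover have "poly q' z \<noteq> 0" if "z \<in> X" for z using Suc.prems(2) [OF that] by (auto simp: q')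
  ultimately obtain G where G: "approximable (\<lambda>z. 1 / poly q' z) G"
    "\<And>x. G (poly_op q' T x) = x" "\<And>x. poly_op q' T (G x) = x"
    using Suc.hyps(1) nz by blast
  obtain R where R: "approximable (\<lambda>z. 1 / (z - a)) R"
    "\<And>x. R (T x - a *\<^sub>C x) = x" "\<And>x. T (R x) - a *\<^sub>C R x = x"
    using approximable_resolvent [OF a] by blast
  have fact: "poly_op q T x = T (poly_op q' T x) - a *\<^sub>C poly_op q' T x" for x
    unfolding q' poly_op_mult [OF T]
    by (simp add: poly_op_pCons [OF T] bounded_clinearD(4) [OF T] scaleC_minus_left)
  have "approximable (\<lambda>z. 1 / poly q z) (\<lambda>x. G (R x))"
    by (rule approximable_cong [OF approximable_mult [OF G(1) R(1)]]) (simp_all add: q' algebra_simps)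
  moreover have "G (R (poly_op q T x)) = x" "poly_op q T (G (R x)) = x" for x
    by (simp_all add: fact R G)
  ultimately show ?case by (intro exI [of _ "\<lambda>x. G (R x)"]) blast
qed

lemma approximable_rational:
  assumes "rat_poles f \<inter> X = {}"
  shows "approximable (rat_eval f) (rat_op f T)"
proof -
  obtain p q where pq: "quot_of_fract f = (p, q)" by (cases "quot_of_fract f")
  have "q \<noteq> 0" using snd_quot_of_fract_nonzero [of f] by (simp add: pq)
  moreover have "poly q z \<noteq> 0" if "z \<in> X" for z
    using assms that by (auto simp: rat_poles_def pq)
  ultimately obtain G where G: "approximable (\<lambda>z. 1 / poly q z) G"
    "\<And>x. G (poly_op q T x) = x" "\<And>x. poly_op q T (G x) = x"
    using approximable_inverse_poly by blast
  have "inv (poly_op q T) = G"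
    by (rule inv_equality) (use G in auto)
  then show ?thesis
    by (intro approximable_cong [OF approximable_mult [OF approximable_poly [of p] G(1)]])
      (simp_all add: rat_eval_def rat_op_def pq)
qed

lemma spectrum_subset: "op_spectrum T \<subseteq> X"
proof
  fix a assume a: "a \<in> op_spectrum T"
  show "a \<in> X"
  proof (rule ccontr)
    assume "a \<notin> X"
    from approximable_resolvent [OF this] obtain R where R: "bounded_clinear R"
      "\<And>x. R (T x - a *\<^sub>C x) = x" "\<And>x. T (R x) - a *\<^sub>C R x = x"
      unfolding approximable_def by blast
    have "bounded_clinear (\<lambda>x. T x - a *\<^sub>C x)"
      using bounded_clinear_add [OF T bounded_clinear_scaleC [of "- a"]]
      by (simp add: scaleC_minus_left)
    with R have "op_invertible (\<lambda>x. T x - a *\<^sub>C x)"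
      unfolding op_invertible_def by (intro conjI exI [of _ R]) (auto simp: fun_eq_iff)
    with a show False by (simp add: op_spectrum_def)
  qed
qed

end

section \<open>Norms of matrices and of block operators\<close>

text \<open>
  A crude bound by the entries, enough for perturbations that tend to zero and for the boundedness that the
  suprema in the definitions require.
\<close>

lemma L2_set_block_le:
  fixes b :: "nat \<Rightarrow> nat \<Rightarrow> 'b::real_normed_vector"
  assumes b: "\<And>i j. \<lbrakk>i < n; j < n\<rbrakk> \<Longrightarrow> norm (b i j) \<le> \<epsilon> * w j"
    and w: "\<And>j. 0 \<le> w j" and eps: "0 \<le> \<epsilon>"
  shows "L2_set (\<lambda>i. norm (\<Sum>j<n. b i j)) {..<n} \<le> (real n)\<^sup>2 * \<epsilon> * L2_set w {..<n}"
proof -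
  have row: "norm (\<Sum>j<n. b i j) \<le> real n * (\<epsilon> * L2_set w {..<n})" if "i < n" for i
  proof -
    have "norm (\<Sum>j<n. b i j) \<le> (\<Sum>j<n. \<epsilon> * L2_set w {..<n})"
    proof (rule sum_norm_le)
      fix j assume "j \<in> {..<n}"
      then have "norm (b i j) \<le> \<epsilon> * w j" "w j \<le> L2_set w {..<n}"
        using b that by (auto intro!: member_le_L2_set)
      then show "norm (b i j) \<le> \<epsilon> * L2_set w {..<n}"
        using mult_left_mono [OF _ eps] by (meson order_trans)
    qed
    then show ?thesis by simp
  qed
  have "L2_set (\<lambda>i. norm (\<Sum>j<n. b i j)) {..<n} \<le> (\<Sum>i<n. norm (\<Sum>j<n. b i j))"
    by (rule L2_set_le_sum) simp
  also have "\<dots> \<le> (\<Sum>i<n. real n * (\<epsilon> * L2_set w {..<n}))"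
    by (rule sum_mono) (simp add: row)
  finally show ?thesis by (simp add: power2_eq_square mult_ac)
qed

lemma L2_set_triangle_perturb:
  fixes a b :: "nat \<Rightarrow> 'b::real_normed_vector"
  shows "L2_set (\<lambda>i. norm (a i)) A \<le> L2_set (\<lambda>i. norm (b i)) A + L2_set (\<lambda>i. norm (a i - b i)) A"
proof -
  have "L2_set (\<lambda>i. norm (a i)) A \<le> L2_set (\<lambda>i. norm (b i) + norm (a i - b i)) A"
    by (rule L2_set_mono) (use norm_triangle_sub in auto)
  also have "\<dots> \<le> L2_set (\<lambda>i. norm (b i)) A + L2_set (\<lambda>i. norm (a i - b i)) A"
    by (rule L2_set_triangle_ineq)
  finally show ?thesis .
qed

lemma mat_onorm_image_bound:
  assumes C: "\<And>i j. \<lbrakk>i < n; j < n\<rbrakk> \<Longrightarrow> cmod (M i j) \<le> C" and C0: "0 \<le> C"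
    and v: "L2_set (\<lambda>j. norm (v j)) {..<n} \<le> 1"
  shows "L2_set (\<lambda>i. norm (\<Sum>j<n. M i j * v j)) {..<n} \<le> (real n)\<^sup>2 * C"
proof -
  have "L2_set (\<lambda>i. norm (\<Sum>j<n. M i j * v j)) {..<n} \<le>
      (real n)\<^sup>2 * C * L2_set (\<lambda>j. norm (v j)) {..<n}"
    by (rule L2_set_block_le) (use C C0 in \<open>auto simp: norm_mult intro!: mult_right_mono\<close>)
  also have "\<dots> \<le> (real n)\<^sup>2 * C * 1"
    by (intro mult_left_mono v) (use C0 in auto)
  finally show ?thesis by simp
qed

lemma mat_onorm_le:
  assumes "\<And>i j. \<lbrakk>i < n; j < n\<rbrakk> \<Longrightarrow> cmod (M i j) \<le> C" and "0 \<le> C"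
  shows "mat_onorm n M \<le> (real n)\<^sup>2 * C"
  unfolding mat_onorm_def block_onorm_def
proof (rule cSUP_least)
  show "{x :: nat \<Rightarrow> complex. L2_set (\<lambda>j. norm (x j)) {..<n} \<le> 1} \<noteq> {}"
    by (auto intro!: exI [of _ "\<lambda>_. 0"] simp: L2_set_def)
qed (use mat_onorm_image_bound [OF assms] in auto)

lemma mat_onorm_upper:
  assumes "L2_set (\<lambda>j. norm (v j)) {..<n} \<le> 1"
  shows "L2_set (\<lambda>i. norm (\<Sum>j<n. M i j * v j)) {..<n} \<le> mat_onorm n M"
  unfolding mat_onorm_def block_onorm_def
proof (rule cSUP_upper)
  define C where "C = (\<Sum>i<n. \<Sum>j<n. cmod (M i j))"
  have C: "cmod (M i j) \<le> C" if "i < n" "j < n" for i j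
  proof -
    have "cmod (M i j) \<le> (\<Sum>j<n. cmod (M i j))" by (rule member_le_sum) (use that in auto)
    also have "\<dots> \<le> C" unfolding C_def
      by (rule member_le_sum [where f = "\<lambda>i. \<Sum>j<n. cmod (M i j)"]) (use that in \<open>auto intro: sum_nonneg\<close>)
    finally show ?thesis .
  qed
  have "0 \<le> C" by (simp add: C_def sum_nonneg)
  then show "bdd_above ((\<lambda>x. L2_set (\<lambda>i. norm (\<Sum>j<n. M i j * x j)) {..<n}) `
      {x. L2_set (\<lambda>j. norm (x j)) {..<n} \<le> 1})"
    using mat_onorm_image_bound [OF C] by (intro bdd_aboveI2) auto
qed (use assms in simp)

lemma mat_onorm_nonneg: "0 \<le> mat_onorm n M"
  using mat_onorm_upper [where v = "\<lambda>_. 0" and n = n and M = M] by (simp add: L2_set_def)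

text \<open>
  The homogeneous form of \<open>mat_onorm_upper\<close>. A vector of norm zero, for which
  scaling is impossible, has only zero coordinates below \<open>n\<close>.
\<close>

lemma mat_onorm_bound:
  "L2_set (\<lambda>i. norm (\<Sum>j<n. M i j * v j)) {..<n} \<le> mat_onorm n M * L2_set (\<lambda>j. norm (v j)) {..<n}"
proof (cases "L2_set (\<lambda>j. norm (v j)) {..<n} = 0")
  case True
  then have "v j = 0" if "j < n" for j using that by (simp add: L2_set_eq_0_iff)
  then have "(\<Sum>j<n. M i j * v j) = 0" for i by (intro sum.neutral) auto
  then show ?thesis using True by (simp add: L2_set_def)
next
  case False
  define l where "l = L2_set (\<lambda>j. norm (v j)) {..<n}"
  have l: "l > 0" using False by (simp add: l_def less_le)
  define u where "u j = v j / of_real l" for j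
  have "L2_set (\<lambda>j. norm (u j)) {..<n} = 1 / l * l"
  proof -
    have "norm (u j) = 1 / l * norm (v j)" for j using l by (simp add: u_def norm_divide)
    then have "L2_set (\<lambda>j. norm (u j)) {..<n} = L2_set (\<lambda>j. 1 / l * norm (v j)) {..<n}"
      by (simp only:)
    also have "\<dots> = 1 / l * l"
      unfolding l_def by (rule L2_set_right_distrib [symmetric]) (use l in \<open>simp add: l_def\<close>)
    finally show ?thesis .
  qed
  then have "L2_set (\<lambda>i. norm (\<Sum>j<n. M i j * u j)) {..<n} \<le> mat_onorm n M"
    using l by (intro mat_onorm_upper) simp
  moreover have "norm (\<Sum>j<n. M i j * v j) = l * norm (\<Sum>j<n. M i j * u j)" for i
  proof -
    have "(\<Sum>j<n. M i j * v j) = of_real l * (\<Sum>j<n. M i j * u j)"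
      using l by (simp add: sum_distrib_left u_def)
    then show ?thesis using l by (simp add: norm_mult)
  qed
  then have "L2_set (\<lambda>i. norm (\<Sum>j<n. M i j * v j)) {..<n} =
      l * L2_set (\<lambda>i. norm (\<Sum>j<n. M i j * u j)) {..<n}"
    using l by (simp add: L2_set_right_distrib)
  ultimately show ?thesis
    using l by (simp add: l_def [symmetric] mult.commute)
qed


section \<open>The annulus as a complete spectral set\<close>

context annulus_operator
begin

lemma laurent_matrix_bound:
  fixes q :: "nat \<Rightarrow> nat \<Rightarrow> complex poly" and x :: "nat \<Rightarrow> 'a"
  assumes M: "0 \<le> M"
    and bound: "\<And>z v. z \<in> X \<Longrightarrow>
      L2_set (\<lambda>i. cmod (\<Sum>j<n. poly (q i j) z / z ^ K * v j)) {..<n}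
        \<le> M * L2_set (\<lambda>j. cmod (v j)) {..<n}"
  shows "L2_set (\<lambda>i. norm (\<Sum>j<n. laurent_op K (q i j) (x j))) {..<n}
    \<le> sqrt 2 * M * L2_set (\<lambda>j. norm (x j)) {..<n}"
proof -
  define deg where "deg = (\<Sum>i<n. \<Sum>j<n. degree (q i j))"
  have deg: "degree (q i j) \<le> deg" if "i < n" "j < n" for i j
  proof -
    have "degree (q i j) \<le> (\<Sum>j<n. degree (q i j))" by (rule member_le_sum) (use that in auto)
    also have "\<dots> \<le> deg" unfolding deg_def
      by (rule member_le_sum [where f = "\<lambda>i. \<Sum>j<n. degree (q i j)"]) (use that in auto)
    finally show ?thesis .
  qed
  define F where "F i j k = coeff (q i j) k" for i j k
  define p where "p k = int k - int K" for k
  have symbol: "(\<Sum>k\<le>deg. F i j k * z powi p k) = poly (q i j) z / z ^ K"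
    if "i < n" "j < n" "z \<noteq> 0" for i j z
  proof -
    have "poly (q i j) z = (\<Sum>k\<le>deg. coeff (q i j) k * z ^ k)"
      unfolding poly_altdef
      by (rule sum.mono_neutral_left) (use deg [OF that(1,2)] in \<open>auto simp: coeff_eq_0\<close>)
    then show ?thesis
      using that(3) by (simp add: F_def p_def power_int_diff sum_divide_distrib)
  qed
  have operator: "(\<Sum>k\<le>deg. F i j k *\<^sub>C Tp (p k) u) = laurent_op K (q i j) u"
    if "i < n" "j < n" for i j u
    using poly_op_upto [OF deg [OF that], of T u]
    by (simp add: laurent_op_def F_def p_def funpow_Tp Tp_simps Tp_add)
  have square: "(\<Sum>i<n. (cmod (\<Sum>j<n. (\<Sum>k\<le>deg. F i j k * z powi p k) * v j))\<^sup>2)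
        \<le> M\<^sup>2 * (\<Sum>j<n. (cmod (v j))\<^sup>2)" if z: "z \<in> X" for z v
  proof -
    have "(\<Sum>i<n. (cmod (\<Sum>j<n. (\<Sum>k\<le>deg. F i j k * z powi p k) * v j))\<^sup>2) =
        (L2_set (\<lambda>i. cmod (\<Sum>j<n. poly (q i j) z / z ^ K * v j)) {..<n})\<^sup>2"
      by (simp add: L2_set_def sum_nonneg symbol X_nonzero [OF z])
    also have "\<dots> \<le> (M * L2_set (\<lambda>j. cmod (v j)) {..<n})\<^sup>2"
      by (rule power_mono [OF bound [OF z]]) simp
    finally show ?thesis by (simp add: L2_set_def sum_nonneg power_mult_distrib)
  qed
  have "(\<Sum>i<n. (norm (\<Sum>j<n. \<Sum>k\<le>deg. F i j k *\<^sub>C Tp (p k) (x j)))\<^sup>2)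
    \<le> 2 * M\<^sup>2 * (\<Sum>j<n. (norm (x j))\<^sup>2)"
    by (rule laurent_estimate; (rule square)?) (use r in \<open>auto simp: closed_annulus_def\<close>)
  then have "(\<Sum>i<n. (norm (\<Sum>j<n. laurent_op K (q i j) (x j)))\<^sup>2)
    \<le> 2 * M\<^sup>2 * (\<Sum>j<n. (norm (x j))\<^sup>2)"
    by (simp add: operator)
  then have "sqrt (\<Sum>i<n. (norm (\<Sum>j<n. laurent_op K (q i j) (x j)))\<^sup>2)
    \<le> sqrt (2 * M\<^sup>2 * (\<Sum>j<n. (norm (x j))\<^sup>2))"
    by (rule real_sqrt_le_mono)
  then show ?thesis using M by (simp add: L2_set_def real_sqrt_mult)
qed

text \<open>
  Approximating all entries within \<open>\<epsilon>\<close> by Laurent polynomials changes both sides of the estimate for Laurent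
  polynomials by a multiple of \<open>\<epsilon>\<close>.
\<close>

lemma approximable_matrix_bound:
  fixes g :: "nat \<Rightarrow> nat \<Rightarrow> complex \<Rightarrow> complex" and G :: "nat \<Rightarrow> nat \<Rightarrow> 'a \<Rightarrow> 'a"
  assumes M: "0 \<le> M"
    and approx: "\<And>i j. \<lbrakk>i < n; j < n\<rbrakk> \<Longrightarrow> approximable (g i j) (G i j)"
    and bound: "\<And>z v. z \<in> X \<Longrightarrow> L2_set (\<lambda>i. cmod (\<Sum>j<n. g i j z * v j)) {..<n}
        \<le> M * L2_set (\<lambda>j. cmod (v j)) {..<n}"
  shows "L2_set (\<lambda>i. norm (\<Sum>j<n. G i j (x j))) {..<n}
    \<le> sqrt 2 * M * L2_set (\<lambda>j. norm (x j)) {..<n}"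
proof -
  let ?x = "L2_set (\<lambda>j. norm (x j)) {..<n}"
  let ?G = "L2_set (\<lambda>i. norm (\<Sum>j<n. G i j (x j))) {..<n}"
  define N where "N = (real n)\<^sup>2"
  have N: "N \<ge> 0" by (simp add: N_def)
  have step: "?G \<le> sqrt 2 * M * ?x + \<epsilon> * ((sqrt 2 + 1) * N * ?x)" if \<epsilon>: "\<epsilon> > 0" for \<epsilon>
  proof -
    have "\<exists>K q. i < n \<longrightarrow> j < n \<longrightarrow> (\<forall>z\<in>X. cmod (g i j z - poly q z / z ^ K) \<le> \<epsilon>) \<and>
        (\<forall>x. norm (G i j x - laurent_op K q x) \<le> \<epsilon> * norm x)" for i j
      using approx [of i j] \<epsilon> unfolding approximable_def by blast
    then obtain K q where
      Kq: "\<And>i j z. \<lbrakk>i < n; j < n; z \<in> X\<rbrakk> \<Longrightarrow> cmod (g i j z - poly (q i j) z / z ^ K i j) \<le> \<epsilon>"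
        "\<And>i j x. \<lbrakk>i < n; j < n\<rbrakk> \<Longrightarrow> norm (G i j x - laurent_op (K i j) (q i j) x) \<le> \<epsilon> * norm x"
      by metis
    define L where "L = (\<Sum>i<n. \<Sum>j<n. K i j)"
    have L: "K i j \<le> L" if "i < n" "j < n" for i j
    proof -
      have "K i j \<le> (\<Sum>j<n. K i j)" by (rule member_le_sum) (use that in auto)
      also have "\<dots> \<le> L" unfolding L_def
        by (rule member_le_sum [where f = "\<lambda>i. \<Sum>j<n. K i j"]) (use that in auto)
      finally show ?thesis .
    qed
    \<comment> \<open>a common power of \<open>z\<close> in all denominators\<close>
    define q' where "q' i j = q i j * monom 1 (L - K i j)" for i j
    have lift: "laurent_op L (q' i j) x = laurent_op (K i j) (q i j) x"
      if "i < n" "j < n" for i j x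
      using laurent_op_lift [of "K i j" "L - K i j"] L [OF that] by (simp add: q'_def)
    have lift': "poly (q' i j) z / z ^ L = poly (q i j) z / z ^ K i j"
      if "i < n" "j < n" "z \<in> X" for i j z
    proof -
      have "z ^ L = z ^ K i j * z ^ (L - K i j)"
        using L [OF that(1,2)] by (simp flip: power_add)
      then show ?thesis using X_nonzero [OF that(3)] by (simp add: q'_def poly_monom)
    qed
    have "L2_set (\<lambda>i. cmod (\<Sum>j<n. poly (q' i j) z / z ^ L * v j)) {..<n}
        \<le> (M + N * \<epsilon>) * L2_set (\<lambda>j. cmod (v j)) {..<n}" if z: "z \<in> X" for z v
    proof -
      let ?h = "\<lambda>i j. poly (q' i j) z / z ^ L"
      have "L2_set (\<lambda>i. cmod (\<Sum>j<n. ?h i j * v j)) {..<n} \<le>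
          L2_set (\<lambda>i. cmod (\<Sum>j<n. g i j z * v j)) {..<n} +
          L2_set (\<lambda>i. cmod ((\<Sum>j<n. ?h i j * v j) - (\<Sum>j<n. g i j z * v j))) {..<n}"
        by (rule L2_set_triangle_perturb)
      also have "L2_set (\<lambda>i. cmod ((\<Sum>j<n. ?h i j * v j) - (\<Sum>j<n. g i j z * v j))) {..<n} =
          L2_set (\<lambda>i. cmod (\<Sum>j<n. (?h i j - g i j z) * v j)) {..<n}"
        by (simp add: sum_subtractf left_diff_distrib)
      also have "\<dots> \<le> N * \<epsilon> * L2_set (\<lambda>j. cmod (v j)) {..<n}"
        unfolding N_def
      proof (rule L2_set_block_le)
        fix i j assume "i < n" "j < n"
        then have "cmod (?h i j - g i j z) \<le> \<epsilon>"
          using Kq(1) [of i j z] z by (simp add: lift' norm_minus_commute)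
        then show "cmod ((?h i j - g i j z) * v j) \<le> \<epsilon> * cmod (v j)"
          by (simp add: norm_mult mult_right_mono)
      qed (use \<epsilon> in auto)
      also have "L2_set (\<lambda>i. cmod (\<Sum>j<n. g i j z * v j)) {..<n} \<le> M * L2_set (\<lambda>j. cmod (v j)) {..<n}"
        by (rule bound [OF z])
      finally show ?thesis by (simp add: distrib_right)
    qed
    then have *: "L2_set (\<lambda>i. norm (\<Sum>j<n. laurent_op L (q' i j) (x j))) {..<n}
        \<le> sqrt 2 * (M + N * \<epsilon>) * ?x"
      by (rule laurent_matrix_bound [rotated]) (use M N \<epsilon> in auto)
    have "?G \<le> L2_set (\<lambda>i. norm (\<Sum>j<n. laurent_op L (q' i j) (x j))) {..<n} +
        L2_set (\<lambda>i. norm ((\<Sum>j<n. G i j (x j)) - (\<Sum>j<n. laurent_op L (q' i j) (x j)))) {..<n}"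
      by (rule L2_set_triangle_perturb)
    also have "L2_set (\<lambda>i. norm ((\<Sum>j<n. G i j (x j)) - (\<Sum>j<n. laurent_op L (q' i j) (x j)))) {..<n} =
        L2_set (\<lambda>i. norm (\<Sum>j<n. G i j (x j) - laurent_op L (q' i j) (x j))) {..<n}"
      by (simp add: sum_subtractf)
    also have "\<dots> \<le> N * \<epsilon> * ?x"
      unfolding N_def by (rule L2_set_block_le) (use Kq(2) \<epsilon> in \<open>auto simp: lift\<close>)
    finally show ?thesis using * by (simp add: algebra_simps)
  qed
  show ?thesis
  proof (rule ccontr)
    let ?C = "(sqrt 2 + 1) * N * ?x"
    assume "\<not> ?thesis"
    then have pos: "0 < ?G - sqrt 2 * M * ?x" by simp
    have C: "0 \<le> ?C" using N by simp
    define \<epsilon> where "\<epsilon> = (?G - sqrt 2 * M * ?x) / (?C + 1)"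
    have "\<epsilon> > 0" using pos C by (simp add: \<epsilon>_def)
    from step [OF this] have "\<epsilon> * (?C + 1) \<le> \<epsilon> * ?C" using C by (simp add: \<epsilon>_def)
    with \<open>\<epsilon> > 0\<close> show False by (simp add: distrib_left)
  qed
qed

end

theorem theorem4p2:
  fixes r :: real and T :: "'a::chilbert_space \<Rightarrow> 'a"
  assumes "0 < r" and "r < 1"
    and "bounded_clinear T" and "op_invertible T"
    and "op_nonneg (\<lambda>x. - (cadjoint T ^^ 2) ((T ^^ 2) x)
           + (1 + r\<^sup>2) *\<^sub>R cadjoint T (T x) - r\<^sup>2 *\<^sub>R x)"
  shows "complete_spectral_set (sqrt 2) (closed_annulus r) T"
proof -
  obtain S where S: "bounded_clinear S" "S \<circ> T = id" "T \<circ> S = id"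
    using assms(4) unfolding op_invertible_def by blast
  have defect: "(norm (T (T x)))\<^sup>2 + r\<^sup>2 * (norm x)\<^sup>2 \<le> (1 + r\<^sup>2) * (norm (T x))\<^sup>2" for x
  proof -
    have adj: "Re (cinner (cadjoint T y) x) = Re (cinner y (T x))" for x y
    proof -
      have "cinner (cadjoint T y) x = cnj (cinner (T x) y)"
        unfolding cadjoint [OF assms(3)] by (rule cinner_commute)
      also have "\<dots> = cinner y (T x)" by (rule cinner_commute [symmetric])
      finally show ?thesis by simp
    qed
    have self: "Re (cinner y y) = (norm y)\<^sup>2" for y :: 'a
      by (simp only: cinner_norm Re_complex_of_real)
    have scale: "Re (cinner (t *\<^sub>R y) x) = t * Re (cinner y x)" for t and y :: 'a
      by (simp add: scaleC_of_real [symmetric] cinner_scaleC_left)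
    have "0 \<le> Re (cinner (- (cadjoint T ^^ 2) ((T ^^ 2) x)
           + (1 + r\<^sup>2) *\<^sub>R cadjoint T (T x) - r\<^sup>2 *\<^sub>R x) x)"
      using assms(5) by (simp only: op_nonneg_def)
    also have "\<dots> = - Re (cinner (cadjoint T (cadjoint T (T (T x)))) x)
        + (1 + r\<^sup>2) * Re (cinner (cadjoint T (T x)) x) - r\<^sup>2 * Re (cinner x x)"
      by (simp only: cinner.diff_left cinner.add_left cinner.minus_left scale
          numeral_2_eq_2 funpow.simps o_apply id_apply
          minus_complex.sel plus_complex.sel uminus_complex.sel)
    finally show ?thesis by (simp only: adj self)
  qed
  interpret annulus_operator T S r
  proof
    show "S (T x) = x" "T (S x) = x" for x
      using fun_cong [OF S(2), of x] fun_cong [OF S(3), of x] by simp_all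
  qed (use assms S defect in simp_all)
  show ?thesis
    unfolding complete_spectral_set_def
  proof (intro conjI allI impI spectrum_subset)
    fix n :: nat and f :: "nat \<Rightarrow> nat \<Rightarrow> complex poly fract"
    assume "\<forall>i<n. \<forall>j<n. rat_poles (f i j) \<inter> closed_annulus r = {}"
    then have approx: "approximable (rat_eval (f i j)) (rat_op (f i j) T)" if "i < n" "j < n" for i j
      using that by (intro approximable_rational) auto
    let ?m = "\<lambda>z. mat_onorm n (\<lambda>i j. rat_eval (f i j) z)"
    define M where "M = (SUP z\<in>closed_annulus r. ?m z)"
    have "\<exists>C. i < n \<longrightarrow> j < n \<longrightarrow> (\<forall>z\<in>X. cmod (rat_eval (f i j) z) \<le> C)" for i j
      using approx [of i j] unfolding approximable_def by blast
    then obtain c where c: "\<And>i j z. \<lbrakk>i < n; j < n; z \<in> X\<rbrakk> \<Longrightarrow> cmod (rat_eval (f i j) z) \<le> c i j"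
      by metis
    define C where "C = (\<Sum>i<n. \<Sum>j<n. \<bar>c i j\<bar>)"
    have C: "cmod (rat_eval (f i j) z) \<le> C" if "i < n" "j < n" "z \<in> X" for i j z
    proof -
      have "\<bar>c i j\<bar> \<le> (\<Sum>j<n. \<bar>c i j\<bar>)" by (rule member_le_sum) (use that in auto)
      also have "\<dots> \<le> C" unfolding C_def
        by (rule member_le_sum [where f = "\<lambda>i. \<Sum>j<n. \<bar>c i j\<bar>"]) (use that in \<open>auto intro: sum_nonneg\<close>)
      finally show ?thesis using c [OF that] by linarith
    qed
    have "0 \<le> C" by (simp add: C_def sum_nonneg)
    then have bdd: "bdd_above (?m ` X)"
      using C by (intro bdd_aboveI2 [where M = "(real n)\<^sup>2 * C"] mat_onorm_le) auto
    have M_upper: "?m z \<le> M" if "z \<in> X" for z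
      unfolding M_def by (rule cSUP_upper [OF that bdd])
    have "1 \<in> X" using assms(2) by (simp add: closed_annulus_def)
    then have M: "0 \<le> M" using M_upper mat_onorm_nonneg order_trans by blast
    have bound: "L2_set (\<lambda>i. cmod (\<Sum>j<n. rat_eval (f i j) z * v j)) {..<n}
        \<le> M * L2_set (\<lambda>j. cmod (v j)) {..<n}" if "z \<in> X" for z v
      using mat_onorm_bound [where n = n and M = "\<lambda>i j. rat_eval (f i j) z" and v = v]
        mult_right_mono [OF M_upper [OF that], of "L2_set (\<lambda>j. cmod (v j)) {..<n}"]
      by simp
    show "block_onorm n (\<lambda>i j. rat_op (f i j) T) \<le> sqrt 2 * M"
      unfolding block_onorm_def
    proof (rule cSUP_least)
      show "{x :: nat \<Rightarrow> 'a. L2_set (\<lambda>j. norm (x j)) {..<n} \<le> 1} \<noteq> {}"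
        by (auto intro!: exI [of _ "\<lambda>_. 0"] simp: L2_set_def)
      fix x :: "nat \<Rightarrow> 'a" assume "x \<in> {x. L2_set (\<lambda>j. norm (x j)) {..<n} \<le> 1}"
      then have x: "L2_set (\<lambda>j. norm (x j)) {..<n} \<le> 1" by simp
      have "L2_set (\<lambda>i. norm (\<Sum>j<n. rat_op (f i j) T (x j))) {..<n}
          \<le> sqrt 2 * M * L2_set (\<lambda>j. norm (x j)) {..<n}"
        by (rule approximable_matrix_bound [OF M approx bound])
      also have "\<dots> \<le> sqrt 2 * M * 1" by (intro mult_left_mono x) (use M in simp)
      finally show "L2_set (\<lambda>i. norm (\<Sum>j<n. rat_op (f i j) T (x j))) {..<n} \<le> sqrt 2 * M" by simp
    qed
  qed
qed

end
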